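(* Let $m\ge1/2$ and $a>0$ be fixed. Consider the boundary value problem $$(\Phi''+\Phi\Phi')'=\frac{2m-1}{m}(\Phi')^2,\quad -\infty<\tau\le0,$$ $$\lim_{\tau\to-\infty}e^{-\varepsilon\tau}[\Phi(\tau)+a]=\lim_{\tau\to-\infty}e^{-\varepsilon\tau}\Phi'(\tau)=\lim_{\tau\to-\infty}e^{-\varepsilon\tau}\Phi''(\tau)=0\quad\forall\,\varepsilon\in(0,a),\qquad \Phi(0)=0.$$ It has a unique solution $\Phi_m(\tau,a)$. This solution is convex and strictly increasing on $(-\infty,0]$, it belongs to the Lyapunov family (see context) with some $d=d(m,a)>0$, and it satisfies, for $\tau\le 0$, $$\Phi_m''(\tau)+\Phi_m(\tau)\Phi_m'(\tau)=\frac{2m-1}{m}\int_{-\infty}^\tau[\Phi_m'(t)]^2dt,$$ $$\Phi_m'(\tau)=\frac{a^2-\Phi_m^2(\tau)}{2}+\frac{2m-1}{m}\int_{-\infty}^\tau(\tau-s)[\Phi_m'(s)]^2ds,$$ and in particular $$\Phi_m''(0)=\frac{2m-1}{m}\int_{-\infty}^0[\Phi_m'(t)]^2dt,\qquad \Phi_m'(0)=\frac{a^2}{2}-\frac{2m-1}{m}\int_{-\infty}^0 s[\Phi_m'(s)]^2ds .$$ Moreover, $$a\,[e^{a\tau}-1]\le\Phi_m(\tau,a)\le a\tanh(a\tau/2),\qquad \tau\le0.$$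
   Context: Lyapunov family: for $a>0$, $m\neq0$ and a parameter $d\in\mathbb R$, $\Phi_m(\tau,a,d)$ denotes the solution of the ODE given for $|d\,e^{a\tau}|$ small (i.e. near $\tau=-\infty$) by the convergent series $$\Phi_m(\tau,a,d)=-a+\sum_{l=1}^\infty h_l d^l e^{la\tau},\quad h_1=1,\quad h_l=\frac{1}{al^2(l-1)}\sum_{k=1}^{l-1}k\Big(\frac{(m-1)(l-k)}{m}-k\Big)h_kh_{l-k}\ (l\ge2),$$ and continued to the right as a solution of the ODE. *)

theory Defs
  imports "HOL-Analysis.Analysis"
begin

text \<open>Derivatives are taken within the domain, so at a right end point they are one-sided.\<close>

definition deriv_on :: "real set \<Rightarrow> (real \<Rightarrow> real) \<Rightarrow> real \<Rightarrow> real" where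
  "deriv_on S f t = vector_derivative f (at t within S)"

definition ode_solution_on :: "real \<Rightarrow> real set \<Rightarrow> (real \<Rightarrow> real) \<Rightarrow> bool" where
  "ode_solution_on m S \<Phi> \<longleftrightarrow>
     \<Phi> differentiable_on S \<and>
     deriv_on S \<Phi> differentiable_on S \<and>
     (\<forall>t\<in>S. ((\<lambda>s. deriv_on S (deriv_on S \<Phi>) s + \<Phi> s * deriv_on S \<Phi> s)
               has_real_derivative (2 * m - 1) / m * (deriv_on S \<Phi> t)\<^sup>2) (at t within S))"

definition bvp_solution :: "real \<Rightarrow> real \<Rightarrow> (real \<Rightarrow> real) \<Rightarrow> bool" where
  "bvp_solution m a \<Phi> \<longleftrightarrow>
     ode_solution_on m {..0} \<Phi> \<and>
     (\<forall>\<epsilon>\<in>{0<..<a}.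
        ((\<lambda>\<tau>. exp (- \<epsilon> * \<tau>) * (\<Phi> \<tau> + a)) \<longlongrightarrow> 0) at_bot \<and>
        ((\<lambda>\<tau>. exp (- \<epsilon> * \<tau>) * deriv_on {..0} \<Phi> \<tau>) \<longlongrightarrow> 0) at_bot \<and>
        ((\<lambda>\<tau>. exp (- \<epsilon> * \<tau>) * deriv_on {..0} (deriv_on {..0} \<Phi>) \<tau>) \<longlongrightarrow> 0) at_bot) \<and>
     \<Phi> 0 = 0"

text \<open>The coefficients $h_l$ are indexed from $l = 1$; the value at $0$ is a dummy.\<close>

fun lyap_coeff :: "real \<Rightarrow> real \<Rightarrow> nat \<Rightarrow> real" where
  "lyap_coeff m a l =
     (if l = 0 then 0 else if l = 1 then 1
      else 1 / (a * (real l)\<^sup>2 * (real l - 1)) *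
        (\<Sum>k = 1..l - 1. real k * ((m - 1) * (real l - real k) / m - real k)
            * lyap_coeff m a k * lyap_coeff m a (l - k)))"

declare lyap_coeff.simps [simp del]

text \<open>\<open>\<Phi>\<close> agrees on \<open>(-\<infinity>, T]\<close> with the Lyapunov family member of parameter \<open>d\<close>:
  it solves the equation on all of \<open>(-\<infinity>, T]\<close> and is the sum of the series
  wherever \<open>\<bar>d e\<^sup>a\<^sup>\<tau>\<bar>\<close> is small.\<close>

definition lyapunov_solution :: "real \<Rightarrow> real \<Rightarrow> real \<Rightarrow> real \<Rightarrow> (real \<Rightarrow> real) \<Rightarrow> bool" where
  "lyapunov_solution m a d T \<Phi> \<longleftrightarrow>
     ode_solution_on m {..T} \<Phi> \<and>
     (\<exists>\<delta>>0. \<forall>\<tau>\<le>T. \<bar>d * exp (a * \<tau>)\<bar> < \<delta> \<longrightarrow>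
        (\<lambda>n. lyap_coeff m a (Suc n) * d ^ Suc n * exp (real (Suc n) * a * \<tau>))
          sums (\<Phi> \<tau> + a))"

end

theory Submission
  imports Defs
begin

text \<open>
  Write \<open>c = (2 m - 1) / m\<close>, so that \<open>0 \<le> c < 2\<close>, and
  \<open>P = \<Phi>'\<close>, \<open>Q = \<Phi>''\<close>. The equation can be integrated twice from minus
  infinity, \<open>Q + \<Phi> P = c \<integral> P\<^sup>2\<close> and
  \<open>P = (a\<^sup>2 - \<Phi>\<^sup>2) / 2 + c \<integral>\<integral> P\<^sup>2\<close>; almost
  everything is read off from these two first order relations.

  The first relation makes \<open>P e\<^sup>-\<^sup>a\<^sup>\<tau>\<close> converge at minus infinity. Its
  limit, the amplitude, is \<open>a d\<close> for the member of the Lyapunov family with parameter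
  \<open>d\<close>. A weighted contraction argument shows that the amplitude determines the solution
  (\<open>same_amplitude_imp_equal\<close>), and a translation in \<open>\<tau>\<close> multiplies the
  amplitude by a positive factor. Hence, once the amplitude is known to be positive, two solutions of the
  boundary value problem are translates of each other, and as both are strictly increasing with value zero at
  \<open>0\<close> the translation is trivial.

  The sign of the amplitude (\<open>amplitude_pos\<close>) is the delicate point. Amplitude zero forces
  \<open>\<Phi> = -a\<close>. For a negative amplitude one has to exclude that \<open>\<Phi>\<close>
  decreases at first and then returns to zero; this is done by showing that \<open>Q / P\<close> is monotone
  as long as \<open>P\<close> and \<open>Q\<close> keep their sign (\<open>Q_le_aP\<close>), so that
  \<open>Q \<le> a P < 0\<close> persists. For a positive amplitude the same fact yields
  \<open>\<Phi>' \<le> a (\<Phi> + a)\<close> and with it the exponential lower bound. The upper bound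
  holds because the second relation makes
  \<open>e\<^sup>-\<^sup>a\<^sup>\<tau> (a + \<Phi>) / (a - \<Phi>)\<close>, which is constant for the
  hyperbolic tangent, nondecreasing.

  For existence, the series itself reaches far enough. Symmetrising the recursion gives
  \<open>\<bar>h\<^sub>l\<bar> \<le> A\<^sup>l\<^sup>-\<^sup>1\<close> with
  \<open>A = (1 - c / 3) / (2 a)\<close> (\<open>lyap_coeff_bound\<close>). If
  \<open>c > 0\<close>, the series therefore still converges for \<open>d = 2 a\<close>, and there the
  monotone quotient above, which starts from \<open>d / (2 a) = 1\<close>, shows that
  \<open>\<Phi> 0 \<ge> 0\<close>. The intermediate value theorem gives a parameter \<open>d\<close> in
  \<open>(0, 2 a]\<close> with \<open>\<Phi> 0 = 0\<close>. If \<open>c = 0\<close>, the series is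
  geometric and its sum \<open>a tanh (a \<tau> / 2)\<close> can be checked directly.
\<close>

section \<open>Comparison arguments on the half line\<close>

text \<open>
  One-sided at \<open>0\<close>: this is the sense in which the boundary value problem is posed.
\<close>

abbreviation has_deriv_half_line :: "(real \<Rightarrow> real) \<Rightarrow> (real \<Rightarrow> real) \<Rightarrow> bool" where
  "has_deriv_half_line f f' \<equiv> \<forall>t\<le>0. (f has_real_derivative f' t) (at t within {..0})"

lemma at_within_half_line: "t < 0 \<Longrightarrow> at t within {..0::real} = at t"
  by (rule at_within_interior) (simp add: interior_real_atMost)

lemma half_line_not_isolated: "t \<le> 0 \<Longrightarrow> at t within {..0::real} \<noteq> bot"
  by (metis at_within_half_line at_neq_bot at_within_Iic_at_left less_eq_real_def
      trivial_limit_at_left_real)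

lemma deriv_half_line_imp_continuous_on:
  "has_deriv_half_line f f' \<Longrightarrow> continuous_on {..0} f"
  by (auto intro: DERIV_continuous_on)

lemma deriv_nonneg_imp_le:
  assumes f: "has_deriv_half_line f f'" and nonneg: "\<And>t. t \<le> 0 \<Longrightarrow> 0 \<le> f' t"
    and st: "s \<le> t" "t \<le> 0"
  shows "f s \<le> f t"
proof (rule DERIV_nonneg_imp_increasing_open[OF st(1)])
  fix x assume "s < x" "x < t"
  then have "x < 0" using st by simp
  then show "\<exists>y. DERIV f x :> y \<and> y \<ge> 0"
    using f nonneg at_within_half_line by (intro exI[of _ "f' x"]) (metis less_imp_le)
next
  show "continuous_on {s..t} f"
    using deriv_half_line_imp_continuous_on[OF f] st by (rule_tac continuous_on_subset) auto
qed

lemma deriv_pos_imp_less: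
  assumes f: "has_deriv_half_line f f'" and pos: "\<And>t. t \<le> 0 \<Longrightarrow> 0 < f' t"
    and st: "s < t" "t \<le> 0"
  shows "f s < f t"
proof (rule DERIV_pos_imp_increasing_open[OF st(1)])
  fix x assume "s < x" "x < t"
  then have "x < 0" using st by simp
  then show "\<exists>y. DERIV f x :> y \<and> y > 0"
    using f pos at_within_half_line by (intro exI[of _ "f' x"]) (metis less_imp_le)
next
  show "continuous_on {s..t} f"
    using deriv_half_line_imp_continuous_on[OF f] st by (rule_tac continuous_on_subset) auto
qed

lemma eventually_at_bot_half_line: "(\<And>s. s \<le> t \<Longrightarrow> P s) \<Longrightarrow> eventually P (at_bot::real filter)"
  by (auto simp: eventually_at_bot_linorder)

lemma limit_at_bot_le:
  assumes f: "has_deriv_half_line f f'" and nonneg: "\<And>t. t \<le> 0 \<Longrightarrow> 0 \<le> f' t"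
    and lim: "(f \<longlongrightarrow> l) at_bot" and t: "t \<le> 0"
  shows "l \<le> f t"
  by (rule tendsto_upperbound[OF lim eventually_at_bot_half_line[of t]])
     (use deriv_nonneg_imp_le[OF f nonneg _ t] in auto)

text \<open>
  The comparison principle behind all estimates: a function that vanishes at minus infinity is controlled by
  integrating a bound on its derivative, and the integral of the bound is supplied as an explicit primitive
  \<open>h\<close>.
\<close>

lemma abs_le_by_deriv:
  assumes f: "has_deriv_half_line f f'" and h: "has_deriv_half_line h h'"
    and le: "\<And>t. t \<le> 0 \<Longrightarrow> \<bar>f' t\<bar> \<le> h' t"
    and lim: "(f \<longlongrightarrow> 0) at_bot" "(h \<longlongrightarrow> l) at_bot" "0 \<le> l" and t: "t \<le> 0"
  shows "\<bar>f t\<bar> \<le> h t"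
proof -
  have "has_deriv_half_line (\<lambda>t. h t - f t) (\<lambda>t. h' t - f' t)"
    "has_deriv_half_line (\<lambda>t. h t + f t) (\<lambda>t. h' t + f' t)"
    using f h by (auto intro!: DERIV_diff DERIV_add)
  from limit_at_bot_le[OF this(1) _ tendsto_diff[OF lim(2,1)] t]
       limit_at_bot_le[OF this(2) _ tendsto_add[OF lim(2,1)] t]
  have "l \<le> h t - f t" "l \<le> h t + f t"
    using le by fastforce+
  with lim(3) show ?thesis by linarith
qed

lemma constant_of_deriv_zero_at_bot:
  assumes f: "has_deriv_half_line f (\<lambda>_. 0)" and lim: "(f \<longlongrightarrow> l) at_bot" and t: "t \<le> 0"
  shows "f t = l"
proof -
  have "has_deriv_half_line (\<lambda>t. - f t) (\<lambda>_. 0)"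
    using f DERIV_minus by fastforce
  from limit_at_bot_le[OF this _ tendsto_minus[OF lim] t] limit_at_bot_le[OF f _ lim t]
  show ?thesis by simp
qed

lemma exp_scaled_at_bot: "0 < k \<Longrightarrow> ((\<lambda>t. exp (k * t)) \<longlongrightarrow> (0::real)) at_bot"
  by (rule filterlim_compose[OF exp_at_bot])
     (simp add: filterlim_at_bot_mirror filterlim_uminus_at_bot
        filterlim_tendsto_pos_mult_at_top[OF tendsto_const _ filterlim_ident])

lemma exp_multiple_deriv: "has_deriv_half_line (\<lambda>t. C / k * exp (k * t)) (\<lambda>t. C * exp (k * t))"
  if "k \<noteq> 0"
  using that by (auto intro!: derivative_eq_intros)

lemma exp_multiple_at_bot: "0 < k \<Longrightarrow> ((\<lambda>t. C * exp (k * t)) \<longlongrightarrow> (0::real)) at_bot"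
  using tendsto_mult_right_zero[OF exp_scaled_at_bot] by blast

lemma abs_le_exp_of_deriv:
  assumes "has_deriv_half_line f f'" "0 < k" "\<And>t. t \<le> 0 \<Longrightarrow> \<bar>f' t\<bar> \<le> C * exp (k * t)"
    "(f \<longlongrightarrow> 0) at_bot" "t \<le> 0"
  shows "\<bar>f t\<bar> \<le> C / k * exp (k * t)"
  using abs_le_by_deriv[OF assms(1) exp_multiple_deriv assms(3,4) exp_multiple_at_bot] assms
  by auto

text \<open>
  With \<open>e = C / k * exp (k t)\<close>, the function \<open>f + e\<close> is nondecreasing and
  \<open>f - e\<close> is nonincreasing, and the two squeeze the infimum of \<open>f + e\<close>.
\<close>

lemma limit_at_bot_of_deriv_le_exp:
  assumes f: "has_deriv_half_line f f'" and k: "0 < k"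
    and le: "\<And>t. t \<le> 0 \<Longrightarrow> \<bar>f' t\<bar> \<le> C * exp (k * t)"
  obtains l where "(f \<longlongrightarrow> l) at_bot"
proof -
  define e where "e = (\<lambda>t. C / k * exp (k * t))"
  have e: "has_deriv_half_line e (\<lambda>t. C * exp (k * t))" "(e \<longlongrightarrow> 0) at_bot"
    using exp_multiple_deriv[of k C] exp_multiple_at_bot[OF k, of "C / k"] k 
    by (simp_all only: e_def less_imp_neq[symmetric]) simp_all
  have up: "f s + e s \<le> f t + e t" and down: "f t - e t \<le> f s - e s" if "s \<le> t" "t \<le> 0" for s t
  proof -
    have "has_deriv_half_line (\<lambda>t. f t + e t) (\<lambda>t. f' t + C * exp (k * t))"
      "has_deriv_half_line (\<lambda>t. e t - f t) (\<lambda>t. C * exp (k * t) - f' t)"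
      using f e(1) by (auto intro!: DERIV_diff DERIV_add)
    from deriv_nonneg_imp_le[OF this(1) _ that] deriv_nonneg_imp_le[OF this(2) _ that] le
    show "f s + e s \<le> f t + e t" "f t - e t \<le> f s - e s" by fastforce+
  qed
  have e_nonneg: "0 \<le> e t" if "t \<le> 0" for t
  proof -
    have "0 \<le> C * exp (k * t)" using le[OF that] by linarith
    then show ?thesis using k by (simp add: e_def zero_le_mult_iff)
  qed
  have cross: "f t - e t \<le> f s + e s" if "s \<le> 0" "t \<le> 0" for s t
    using up[of t s] down[of s t] that e_nonneg[of s] e_nonneg[of t] by fastforce
  define l where "l = (INF s\<in>{..0}. f s + e s)"
  have "f t - e t \<le> l" "l \<le> f t + e t" if "t \<le> 0" for t
  proof -
    show "f t - e t \<le> l" unfolding l_def using that cross by (intro cINF_greatest) auto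
    show "l \<le> f t + e t" unfolding l_def using that cross[of _ 0]
      by (intro cINF_lower bdd_belowI2[of _ "f 0 - e 0"]) auto
  qed
  then have "\<bar>f t - l\<bar> \<le> e t" if "t \<le> 0" for t using that by fastforce
  then have "((\<lambda>t. f t - l) \<longlongrightarrow> 0) at_bot"
    by (intro Lim_null_comparison[OF eventually_at_bot_half_line[of 0] e(2)]) auto
  then have "(f \<longlongrightarrow> l) at_bot" by (simp add: LIM_zero_cancel)
  then show ?thesis using that by blast
qed

lemma bounded_of_continuous_limit_at_bot:
  assumes f: "continuous_on {..0} f" and lim: "(f \<longlongrightarrow> l) (at_bot::real filter)"
  obtains M :: real where "\<And>t. t \<le> 0 \<Longrightarrow> \<bar>f t\<bar> \<le> M"
proof -
  have "eventually (\<lambda>t. \<bar>f t - l\<bar> < 1) at_bot"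
    using tendstoD[OF lim, of 1] by (simp add: dist_real_def)
  then obtain T where T: "\<And>t. t \<le> T \<Longrightarrow> \<bar>f t - l\<bar> < 1"
    by (auto simp: eventually_at_bot_linorder)
  have "compact (f ` {T..0})"
    using f by (intro compact_continuous_image continuous_on_subset[OF f]) auto
  then obtain B where B: "\<forall>x\<in>f ` {T..0}. \<bar>x\<bar> \<le> B"
    using compact_imp_bounded bounded_real by blast
  have "\<bar>f t\<bar> \<le> max B (\<bar>l\<bar> + 1)" if "t \<le> 0" for t
  proof (cases "t \<le> T")
    case True
    then show ?thesis using T[of t] by linarith
  next
    case False
    then have "\<bar>f t\<bar> \<le> B" using B that by auto
    then show ?thesis by simp
  qed
  then show ?thesis using that by blast
qed

lemma primitive_vanishing_at_bot:
  fixes f :: "real \<Rightarrow> real"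
  assumes f: "continuous_on {..0} f" and k: "0 < k"
    and le: "\<And>t. t \<le> 0 \<Longrightarrow> \<bar>f t\<bar> \<le> C * exp (k * t)"
  obtains F where "has_deriv_half_line F f" "(F \<longlongrightarrow> 0) at_bot"
proof -
  define G where "G = (\<lambda>t. - integral {t..0} f)"
  have G: "has_deriv_half_line G f"
  proof (intro allI impI)
    fix t :: real assume t: "t \<le> 0"
    have "((\<lambda>x. integral {x..0} f) has_vector_derivative - f t) (at t within {t-1..0})"
      using t by (intro integral_has_vector_derivative' continuous_on_subset[OF f]) auto
    moreover have "at t within {t-1..0} = at t within {..0}"
      by (rule at_within_nhd[of _ "{t-1<..}"]) auto
    ultimately show "(G has_real_derivative f t) (at t within {..0})"
      unfolding G_def has_real_derivative_iff_has_vector_derivative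
      using has_vector_derivative_minus by fastforce
  qed
  from limit_at_bot_of_deriv_le_exp[OF G k le] obtain l where l: "(G \<longlongrightarrow> l) at_bot" by blast
  show ?thesis
  proof (rule that)
    show "has_deriv_half_line (\<lambda>t. G t - l) f"
      using G DERIV_diff[OF _ DERIV_const] by fastforce
    show "((\<lambda>t. G t - l) \<longlongrightarrow> 0) at_bot"
      using l by (simp add: LIM_zero)
  qed
qed

lemma exp_set_integrable_atMost:
  assumes k: "0 < k"
  shows "set_integrable lborel {..T} (\<lambda>t::real. exp (k * t))"
proof -
  have "set_integrable lborel (einterval (-\<infinity>) (ereal (T + 1))) (\<lambda>t. exp (k * t))"
  proof (rule interval_integral_FTC_nonneg)
    show "DERIV (\<lambda>t. exp (k * t) / k) x :> exp (k * x)" for x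
      using k by (auto intro!: derivative_eq_intros)
    show "(((\<lambda>t. exp (k * t) / k) \<circ> real_of_ereal) \<longlongrightarrow> 0) (at_right (-\<infinity>))"
      using exp_multiple_at_bot[OF k, of "1 / k"] by (simp add: ereal_tendsto_simps)
    show "(((\<lambda>t. exp (k * t) / k) \<circ> real_of_ereal) \<longlongrightarrow> exp (k * (T + 1)) / k) (at_left (ereal (T + 1)))"
      unfolding ereal_tendsto_simps using k by (intro tendsto_intros) auto
  qed auto
  then show ?thesis
    by (rule set_integrable_subset) (auto simp: einterval_def)
qed

text \<open>
  The exponential bound gives absolute integrability, so the integral over the half line is the limit of
  integrals over compact intervals, and these are evaluated by the fundamental theorem of calculus.
\<close>

lemma has_integral_atMost_of_primitive:
  fixes f F :: "real \<Rightarrow> real"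
  assumes F: "has_deriv_half_line F f" "(F \<longlongrightarrow> 0) at_bot"
    and f: "continuous_on {..0} f" and k: "0 < k"
    and le: "\<And>t. t \<le> 0 \<Longrightarrow> \<bar>f t\<bar> \<le> C * exp (k * t)" and T: "T \<le> 0"
  shows "(f has_integral F T) {..T}"
proof -
  have int: "set_integrable lborel {..T} f"
  proof (rule set_integrable_bound)
    show "set_integrable lborel {..T} (\<lambda>t. C * exp (k * t))"
      by (intro set_integrable_mult_right exp_set_integrable_atMost k)
    show "set_borel_measurable lborel {..T} f"
      using borel_measurable_continuous_on_indicator[of "{..T}" f] T
        continuous_on_subset[OF f, of "{..T}"] by (auto simp: set_borel_measurable_def)
    show "AE x in lborel. x \<in> {..T} \<longrightarrow> norm (f x) \<le> norm (C * exp (k * x))"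
    proof (intro AE_I2 impI)
      fix x assume "x \<in> {..T}"
      then have "\<bar>f x\<bar> \<le> C * exp (k * x)" using le T by auto
      then show "norm (f x) \<le> norm (C * exp (k * x))" unfolding real_norm_def by linarith
    qed
  qed
  have lim: "((\<lambda>s. LINT x:{s..T}|lborel. f x) \<longlongrightarrow> (LINT x:{..T}|lborel. f x)) at_bot"
    by (rule tendsto_set_lebesgue_integral_at_bot) (use int in auto)
  have ev: "eventually (\<lambda>s. (LINT x:{s..T}|lborel. f x) = F T - F s) at_bot"
  proof (rule eventually_at_bot_half_line[of T])
    fix s assume s: "s \<le> T"
    have "(f has_integral F T - F s) {s..T}"
    proof (intro fundamental_theorem_of_calculus[OF s])
      fix x assume "x \<in> {s..T}"
      then have "x \<le> 0" using T by simp
      then show "(F has_vector_derivative f x) (at x within {s..T})"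
        unfolding has_real_derivative_iff_has_vector_derivative[symmetric]
        by (rule DERIV_subset[OF F(1)[rule_format]]) (use T in auto)
    qed
    moreover have "set_integrable lborel {s..T} f"
      by (rule set_integrable_subset[OF int]) auto
    ultimately show "(LINT x:{s..T}|lborel. f x) = F T - F s"
      using set_borel_integral_eq_integral(2) integral_unique by metis
  qed
  have "((\<lambda>s. F T - F s) \<longlongrightarrow> F T - 0) at_bot"
    by (intro tendsto_intros F)
  from tendsto_unique[OF trivial_limit_at_bot_linorder Lim_transform_eventually[OF lim ev] this]
  have "(LINT x:{..T}|lborel. f x) = F T" by simp
  then show ?thesis
    using set_borel_integral_eq_integral[OF int] by (metis integrable_integral)
qed

lemma tail_integral_primitive:
  fixes f :: "real \<Rightarrow> real"
  assumes f: "continuous_on {..0} f" and k: "0 < k"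
    and le: "\<And>t. t \<le> 0 \<Longrightarrow> \<bar>f t\<bar> \<le> C * exp (k * t)"
  shows "has_deriv_half_line (\<lambda>T. integral {..T} f) f"
    and "((\<lambda>T. integral {..T} f) \<longlongrightarrow> 0) at_bot"
proof -
  obtain F where F: "has_deriv_half_line F f" "(F \<longlongrightarrow> 0) at_bot"
    using primitive_vanishing_at_bot[OF f k le] by blast
  have eq: "integral {..T} f = F T" if "T \<le> 0" for T
    using has_integral_atMost_of_primitive[OF F f k le that] by (rule integral_unique)
  show "has_deriv_half_line (\<lambda>T. integral {..T} f) f"
    using F(1) eq unfolding has_field_derivative_def
    by (auto intro: has_derivative_transform[where f = F])
  show "((\<lambda>T. integral {..T} f) \<longlongrightarrow> 0) at_bot"
    by (rule Lim_transform_eventually[OF F(2) eventually_at_bot_half_line[of 0]]) (simp add: eq)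
qed

section \<open>Solutions that decay at minus infinity\<close>

text \<open>
  The equation as a first order system, with \<open>c = (2 m - 1) / m\<close>. The value at
  \<open>0\<close> is left free because the arguments on the sign of the amplitude and the existence proof
  need solutions that are not anchored.
\<close>

locale decaying_solution =
  fixes a c :: real and \<Phi> P Q :: "real \<Rightarrow> real"
  assumes a_pos: "0 < a" and c_nonneg: "0 \<le> c" and c_le_2: "c \<le> 2"
    and Phi_deriv: "has_deriv_half_line \<Phi> P"
    and P_deriv: "has_deriv_half_line P Q"
    and Q_deriv: "has_deriv_half_line Q (\<lambda>t. (c - 1) * (P t)\<^sup>2 - \<Phi> t * Q t)"
    and decay: "\<And>\<epsilon>. \<epsilon> \<in> {0<..<a} \<Longrightarrow> ((\<lambda>t. exp (- \<epsilon> * t) * (\<Phi> t + a)) \<longlongrightarrow> 0) at_bot"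
      "\<And>\<epsilon>. \<epsilon> \<in> {0<..<a} \<Longrightarrow> ((\<lambda>t. exp (- \<epsilon> * t) * P t) \<longlongrightarrow> 0) at_bot"
      "\<And>\<epsilon>. \<epsilon> \<in> {0<..<a} \<Longrightarrow> ((\<lambda>t. exp (- \<epsilon> * t) * Q t) \<longlongrightarrow> 0) at_bot"
begin

lemmas Phi_cont = deriv_half_line_imp_continuous_on[OF Phi_deriv]
  and P_cont = deriv_half_line_imp_continuous_on[OF P_deriv]
  and Q_cont = deriv_half_line_imp_continuous_on[OF Q_deriv]

lemma exponential_bound_of_decay:
  assumes "continuous_on {..0} f" "((\<lambda>t. exp (- \<epsilon> * t) * f t) \<longlongrightarrow> 0) at_bot"
  obtains M :: real where "\<And>t. t \<le> 0 \<Longrightarrow> \<bar>f t\<bar> \<le> M * exp (\<epsilon> * t)"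
proof -
  have "continuous_on {..0} (\<lambda>t. exp (- \<epsilon> * t) * f t)"
    by (intro continuous_intros assms)
  from bounded_of_continuous_limit_at_bot[OF this assms(2)] obtain M
    where "\<And>t. t \<le> 0 \<Longrightarrow> \<bar>exp (- \<epsilon> * t) * f t\<bar> \<le> M" by blast
  then have "\<bar>f t\<bar> \<le> M * exp (\<epsilon> * t)" if "t \<le> 0" for t
    using that by (simp add: abs_mult exp_minus field_simps) (metis mult.commute)
  then show ?thesis using that by blast
qed

text \<open>
  Any exponent strictly between \<open>a / 2\<close> and \<open>a\<close> would do: above
  \<open>a / 2\<close>, products of two decaying quantities are \<open>o(e\<^sup>a\<^sup>t)\<close>.
\<close>

lemma rough_bounds:
  obtains M where "0 \<le> M" "\<And>t. t \<le> 0 \<Longrightarrow> \<bar>\<Phi> t + a\<bar> \<le> M * exp (3 * a / 4 * t)"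
    "\<And>t. t \<le> 0 \<Longrightarrow> \<bar>P t\<bar> \<le> M * exp (3 * a / 4 * t)"
    "\<And>t. t \<le> 0 \<Longrightarrow> \<bar>Q t\<bar> \<le> M * exp (3 * a / 4 * t)"
proof -
  have b: "3 * a / 4 \<in> {0<..<a}" using a_pos by auto
  have "continuous_on {..0} (\<lambda>t. \<Phi> t + a)" by (intro continuous_intros Phi_cont)
  from exponential_bound_of_decay[OF this decay(1)[OF b]] obtain M1
    where 1: "\<And>t. t \<le> 0 \<Longrightarrow> \<bar>\<Phi> t + a\<bar> \<le> M1 * exp (3 * a / 4 * t)" by blast
  from exponential_bound_of_decay[OF P_cont decay(2)[OF b]] obtain M2
    where 2: "\<And>t. t \<le> 0 \<Longrightarrow> \<bar>P t\<bar> \<le> M2 * exp (3 * a / 4 * t)" by blast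
  from exponential_bound_of_decay[OF Q_cont decay(3)[OF b]] obtain M3
    where 3: "\<And>t. t \<le> 0 \<Longrightarrow> \<bar>Q t\<bar> \<le> M3 * exp (3 * a / 4 * t)" by blast
  define M where "M = max 0 (max M1 (max M2 M3))"
  have "M1 \<le> M" "M2 \<le> M" "M3 \<le> M" "0 \<le> M" unfolding M_def by linarith+
  then have "x * exp (3 * a / 4 * t) \<le> M * exp (3 * a / 4 * t)" if "x \<in> {M1, M2, M3}" for x t
    using that by (intro mult_right_mono) auto
  then show ?thesis
    using order_trans[OF 1] order_trans[OF 2] order_trans[OF 3] \<open>0 \<le> M\<close>
    by (intro that[of M]) auto
qed

lemma null_at_bot_of_exp_bound:
  assumes "0 < k" "\<And>t. t \<le> 0 \<Longrightarrow> \<bar>f t\<bar> \<le> M * exp (k * t)"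
  shows "(f \<longlongrightarrow> (0::real)) at_bot"
  by (rule Lim_null_comparison[OF eventually_at_bot_half_line[of 0] exp_multiple_at_bot])
     (use assms in auto)

lemma limits_at_bot: "(\<Phi> \<longlongrightarrow> -a) at_bot" "(P \<longlongrightarrow> 0) at_bot" "(Q \<longlongrightarrow> 0) at_bot"
proof -
  obtain M where M: "0 \<le> M" "\<And>t. t \<le> 0 \<Longrightarrow> \<bar>\<Phi> t + a\<bar> \<le> M * exp (3 * a / 4 * t)"
    "\<And>t. t \<le> 0 \<Longrightarrow> \<bar>P t\<bar> \<le> M * exp (3 * a / 4 * t)"
    "\<And>t. t \<le> 0 \<Longrightarrow> \<bar>Q t\<bar> \<le> M * exp (3 * a / 4 * t)"
    by (rule rough_bounds) blast
  have b: "0 < 3 * a / 4" using a_pos by simp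
  show "(P \<longlongrightarrow> 0) at_bot" "(Q \<longlongrightarrow> 0) at_bot"
    using null_at_bot_of_exp_bound[OF b] M by blast+
  have "((\<lambda>t. \<Phi> t - (-a)) \<longlongrightarrow> 0) at_bot"
    using null_at_bot_of_exp_bound[OF b, of "\<lambda>t. \<Phi> t + a", OF M(2)] by simp
  then show "(\<Phi> \<longlongrightarrow> -a) at_bot" by (rule LIM_zero_cancel)
qed

definition energy :: "real \<Rightarrow> real" where
  "energy t = integral {..t} (\<lambda>s. (P s)\<^sup>2)"

lemma square_exp: "(M * exp (k * t))\<^sup>2 = M\<^sup>2 * exp (2 * k * t)" for M k t :: real
  by (simp add: power_mult_distrib power2_eq_square flip: exp_add)

lemma square_le_exp: "\<bar>x\<bar> \<le> M * exp (k * t) \<Longrightarrow> \<bar>x\<^sup>2\<bar> \<le> M\<^sup>2 * exp (2 * k * t)" for x :: real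
  using power_mono[of "\<bar>x\<bar>" "M * exp (k * t)" 2] by (simp add: square_exp)

lemma P_square_bound:
  obtains M where "\<And>t. t \<le> 0 \<Longrightarrow> \<bar>(P t)\<^sup>2\<bar> \<le> M * exp (3 * a / 2 * t)"
proof -
  obtain M where "0 \<le> M" "\<And>t. t \<le> 0 \<Longrightarrow> \<bar>P t\<bar> \<le> M * exp (3 * a / 4 * t)"
    by (rule rough_bounds) blast
  from square_le_exp[OF this(2)] show ?thesis using that[of "M\<^sup>2"] by simp
qed

lemma P_square_cont: "continuous_on {..0} (\<lambda>s. (P s)\<^sup>2)"
  by (intro continuous_intros P_cont)

lemma energy_deriv: "has_deriv_half_line energy (\<lambda>t. (P t)\<^sup>2)"
  and energy_lim: "(energy \<longlongrightarrow> 0) at_bot"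
proof -
  obtain M where M: "\<And>t. t \<le> 0 \<Longrightarrow> \<bar>(P t)\<^sup>2\<bar> \<le> M * exp (3 * a / 2 * t)"
    by (rule P_square_bound) blast
  have "0 < 3 * a / 2" using a_pos by simp
  note tail = tail_integral_primitive[OF P_square_cont this, of M, folded energy_def]
  show "has_deriv_half_line energy (\<lambda>t. (P t)\<^sup>2)" by (rule tail(1)) (rule M)
  show "(energy \<longlongrightarrow> 0) at_bot" by (rule tail(2)) (rule M)
qed

lemma energy_nonneg: "t \<le> 0 \<Longrightarrow> 0 \<le> energy t"
  using limit_at_bot_le[OF energy_deriv _ energy_lim] by simp

text \<open>
  The two sides have the same derivative by the equation and both tend to zero at minus infinity.
\<close>

lemma first_integral: "t \<le> 0 \<Longrightarrow> Q t + \<Phi> t * P t = c * energy t"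
proof -
  assume t: "t \<le> 0"
  have "has_deriv_half_line (\<lambda>t. Q t + \<Phi> t * P t - c * energy t) (\<lambda>_. 0)"
  proof (intro allI impI)
    fix t :: real assume t: "t \<le> 0"
    show "((\<lambda>t. Q t + \<Phi> t * P t - c * energy t) has_real_derivative 0) (at t within {..0})"
      by (rule derivative_eq_intros Phi_deriv[rule_format, OF t] P_deriv[rule_format, OF t]
          Q_deriv[rule_format, OF t] energy_deriv[rule_format, OF t] refl)+
         (simp add: algebra_simps power2_eq_square)
  qed
  moreover have "((\<lambda>t. Q t + \<Phi> t * P t - c * energy t) \<longlongrightarrow> 0 + (-a) * 0 - c * 0) at_bot"
    by (intro tendsto_intros limits_at_bot energy_lim)
  ultimately show ?thesis using constant_of_deriv_zero_at_bot t by fastforce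
qed

text \<open>
  For the member of the Lyapunov family with parameter \<open>d\<close> this is \<open>a d\<close>.
\<close>

definition amplitude :: real where
  "amplitude = Lim at_bot (\<lambda>t. P t * exp (- a * t))"

text \<open>
  The first integral turns \<open>Q - a P\<close> into a quantity that is quadratic in the decaying terms,
  which is why the derivative is integrable at minus infinity.
\<close>

lemma scaled_P_deriv: "has_deriv_half_line (\<lambda>t. P t * exp (- a * t))
   (\<lambda>t. (c * energy t - (\<Phi> t + a) * P t) * exp (- a * t))"
proof (intro allI impI)
  fix t :: real assume t: "t \<le> 0"
  have "((\<lambda>t. P t * exp (- a * t)) has_real_derivative (Q t - a * P t) * exp (- a * t)) (at t within {..0})"
    by (rule derivative_eq_intros P_deriv[rule_format, OF t] refl)+ (simp add: algebra_simps)
  moreover have "Q t - a * P t = c * energy t - (\<Phi> t + a) * P t"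
    using first_integral[OF t] by (simp add: algebra_simps)
  ultimately show "((\<lambda>t. P t * exp (- a * t)) has_real_derivative
      (c * energy t - (\<Phi> t + a) * P t) * exp (- a * t)) (at t within {..0})" by simp
qed

lemma amplitude_lim: "((\<lambda>t. P t * exp (- a * t)) \<longlongrightarrow> amplitude) at_bot"
proof -
  obtain M where M: "0 \<le> M" "\<And>t. t \<le> 0 \<Longrightarrow> \<bar>\<Phi> t + a\<bar> \<le> M * exp (3 * a / 4 * t)"
    "\<And>t. t \<le> 0 \<Longrightarrow> \<bar>P t\<bar> \<le> M * exp (3 * a / 4 * t)"
    by (rule rough_bounds) blast
  obtain N where N: "\<And>t. t \<le> 0 \<Longrightarrow> \<bar>(P t)\<^sup>2\<bar> \<le> N * exp (3 * a / 2 * t)"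
    by (rule P_square_bound) blast
  have pos: "0 < 3 * a / 2" using a_pos by simp
  have J: "\<bar>energy t\<bar> \<le> N / (3 * a / 2) * exp (3 * a / 2 * t)" if "t \<le> 0" for t
    by (rule abs_le_exp_of_deriv[OF energy_deriv pos N energy_lim that])
  define B where "B = c * (N / (3 * a / 2)) + M\<^sup>2"
  have "\<bar>(c * energy t - (\<Phi> t + a) * P t) * exp (- a * t)\<bar> \<le> B * exp (a / 2 * t)" if t: "t \<le> 0" for t
  proof -
    have "\<bar>(\<Phi> t + a) * P t\<bar> \<le> (M * exp (3 * a / 4 * t)) * (M * exp (3 * a / 4 * t))"
      unfolding abs_mult using M(1) by (intro mult_mono M(2,3) t) auto
    also have "\<dots> = M\<^sup>2 * exp (3 * a / 2 * t)"
      using square_exp[of M "3 * a / 4" t] by (simp add: power2_eq_square)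
    finally have *: "\<bar>(\<Phi> t + a) * P t\<bar> \<le> M\<^sup>2 * exp (3 * a / 2 * t)" .
    have "\<bar>c * energy t - (\<Phi> t + a) * P t\<bar> \<le> c * (N / (3 * a / 2) * exp (3 * a / 2 * t)) + M\<^sup>2 * exp (3 * a / 2 * t)"
    proof -
      have "\<bar>c * energy t\<bar> \<le> c * (N / (3 * a / 2) * exp (3 * a / 2 * t))"
        unfolding abs_mult using mult_left_mono[OF J[OF t] c_nonneg] c_nonneg by simp
      then show ?thesis using * abs_triangle_ineq4[of "c * energy t" "(\<Phi> t + a) * P t"]
        by linarith
    qed
    also have "\<dots> = B * exp (3 * a / 2 * t)" by (simp add: B_def algebra_simps)
    finally have "\<bar>c * energy t - (\<Phi> t + a) * P t\<bar> * exp (- a * t) \<le> B * exp (3 * a / 2 * t) * exp (- a * t)"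
      by (intro mult_right_mono) auto
    also have "\<dots> = B * exp (a / 2 * t)" by (simp add: field_simps flip: exp_add)
    finally show ?thesis by (simp add: abs_mult)
  qed
  from limit_at_bot_of_deriv_le_exp[OF scaled_P_deriv _ this] a_pos
  obtain l where l: "((\<lambda>t. P t * exp (- a * t)) \<longlongrightarrow> l) at_bot" by auto
  then show ?thesis unfolding amplitude_def by (simp add: tendsto_Lim)
qed

text \<open>
  Convergence of \<open>P e\<^sup>-\<^sup>a\<^sup>t\<close> improves the rate from any
  \<open>\<epsilon> < a\<close> to \<open>a\<close> itself, and integration passes it on to
  \<open>\<Phi> + a\<close> and to the energy.
\<close>

lemma sharp_bounds:
  obtains C where "0 < C" "\<And>t. t \<le> 0 \<Longrightarrow> \<bar>\<Phi> t + a\<bar> \<le> C * exp (a * t)"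
    "\<And>t. t \<le> 0 \<Longrightarrow> \<bar>P t\<bar> \<le> C * exp (a * t)"
    "\<And>t. t \<le> 0 \<Longrightarrow> \<bar>energy t\<bar> \<le> C * exp (2 * a * t)"
proof -
  have "continuous_on {..0} (\<lambda>t. P t * exp (- a * t))" by (intro continuous_intros P_cont)
  from bounded_of_continuous_limit_at_bot[OF this amplitude_lim] obtain M
    where M: "\<And>t. t \<le> 0 \<Longrightarrow> \<bar>P t * exp (- a * t)\<bar> \<le> M" by blast
  have P: "\<bar>P t\<bar> \<le> M * exp (a * t)" if "t \<le> 0" for t
  proof -
    have "\<bar>P t * exp (- a * t)\<bar> * exp (a * t) \<le> M * exp (a * t)"
      using M[OF that] by (intro mult_right_mono) auto
    then show ?thesis by (simp add: abs_mult mult.assoc flip: exp_add)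
  qed
  have "((\<lambda>t. \<Phi> t + a) \<longlongrightarrow> -a + a) at_bot" by (intro tendsto_intros limits_at_bot)
  then have lim: "((\<lambda>t. \<Phi> t + a) \<longlongrightarrow> 0) at_bot" by simp
  have "has_deriv_half_line (\<lambda>t. \<Phi> t + a) P"
    using DERIV_add[OF Phi_deriv[rule_format] DERIV_const, of _ a] by simp
  then have Phi: "\<bar>\<Phi> t + a\<bar> \<le> M / a * exp (a * t)" if "t \<le> 0" for t
    by (rule abs_le_exp_of_deriv[OF _ a_pos P lim that])
  have "0 < 2 * a" using a_pos by simp
  then have E: "\<bar>energy t\<bar> \<le> M\<^sup>2 / (2 * a) * exp (2 * a * t)" if "t \<le> 0" for t
    by (rule abs_le_exp_of_deriv[OF energy_deriv _ square_le_exp[OF P] energy_lim that])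
  define C where "C = max 1 (max M (max (M / a) (M\<^sup>2 / (2 * a))))"
  have C: "M \<le> C" "M / a \<le> C" "M\<^sup>2 / (2 * a) \<le> C" "0 < C"
    unfolding C_def by (meson max.cobounded1 max.cobounded2 order_trans zero_less_one less_le_trans)+
  show ?thesis
  proof (rule that[OF C(4)])
    fix t :: real assume t: "t \<le> 0"
    show "\<bar>\<Phi> t + a\<bar> \<le> C * exp (a * t)"
      by (rule order_trans[OF Phi[OF t] mult_right_mono[OF C(2)]]) simp
    show "\<bar>P t\<bar> \<le> C * exp (a * t)"
      by (rule order_trans[OF P[OF t] mult_right_mono[OF C(1)]]) simp
    show "\<bar>energy t\<bar> \<le> C * exp (2 * a * t)"
      by (rule order_trans[OF E[OF t] mult_right_mono[OF C(3)]]) simp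
  qed
qed

end

section \<open>A solution is determined by its amplitude\<close>

lemma half_iterated_bound_imp_zero:
  fixes x w :: "'b \<Rightarrow> real"
  assumes base: "\<And>t. t \<in> T \<Longrightarrow> \<bar>x t\<bar> \<le> M * w t" and M: "0 \<le> M"
    and step: "\<And>E. 0 \<le> E \<Longrightarrow> (\<And>t. t \<in> T \<Longrightarrow> \<bar>x t\<bar> \<le> E * w t) \<Longrightarrow> (\<And>t. t \<in> T \<Longrightarrow> \<bar>x t\<bar> \<le> E / 2 * w t)"
    and t: "t \<in> T"
  shows "x t = 0"
proof -
  have all: "\<forall>t\<in>T. \<bar>x t\<bar> \<le> M * (1/2)^n * w t" for n
  proof (induction n)
    case 0
    then show ?case using base by simp
  next
    case (Suc n)
    have "\<bar>x t\<bar> \<le> (M * (1/2)^n) / 2 * w t" if "t \<in> T" for t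
      using step[of "M * (1/2)^n"] Suc M that by auto
    then show ?case by simp
  qed
  have "(\<lambda>n. (1/2::real) ^ n) \<longlonglongrightarrow> 0" by (simp add: LIMSEQ_realpow_zero)
  then have "(\<lambda>n. M * (1/2)^n * w t) \<longlonglongrightarrow> M * 0 * w t"
    by (intro tendsto_mult tendsto_const)
  then have "\<bar>x t\<bar> \<le> M * 0 * w t"
    by (rule LIMSEQ_le_const) (use all t in auto)
  then show ?thesis by simp
qed

lemma deriv_half_line_diff:
  "has_deriv_half_line f f' \<Longrightarrow> has_deriv_half_line g g' \<Longrightarrow>
    has_deriv_half_line (\<lambda>t. f t - g t) (\<lambda>t. f' t - g' t)"
  by (auto intro: DERIV_diff)

text \<open>
  A Gronwall argument started at minus infinity. For the difference \<open>p\<close> of the derivatives, the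
  equation bounds the derivative of \<open>p e\<^sup>-\<^sup>a\<^sup>t\<close> linearly in terms of
  \<open>p\<close>, with a coefficient proportional to \<open>e\<^sup>a\<^sup>t\<close>. In the weight
  \<open>w t = e\<^sup>a\<^sup>t exp (K e\<^sup>a\<^sup>t)\<close> with \<open>K\<close> large, a bound
  \<open>E w\<close> on \<open>\<bar>p\<bar>\<close> reproduces itself with \<open>E / 2\<close>, on the
  whole half line at once; here the equality of the amplitudes enters, as
  \<open>p e\<^sup>-\<^sup>a\<^sup>t\<close> has to vanish at minus infinity.
\<close>

lemma same_amplitude_imp_equal:
  assumes S1: "decaying_solution a c \<Phi>\<^sub>1 P\<^sub>1 Q\<^sub>1" and S2: "decaying_solution a c \<Phi>\<^sub>2 P\<^sub>2 Q\<^sub>2"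
    and amp: "decaying_solution.amplitude a P\<^sub>1 = decaying_solution.amplitude a P\<^sub>2"
    and t: "t \<le> 0"
  shows "\<Phi>\<^sub>1 t = \<Phi>\<^sub>2 t"
proof -
  interpret A: decaying_solution a c \<Phi>\<^sub>1 P\<^sub>1 Q\<^sub>1 by (rule S1)
  interpret B: decaying_solution a c \<Phi>\<^sub>2 P\<^sub>2 Q\<^sub>2 by (rule S2)
  note a = A.a_pos
  obtain C1 where C1: "0 < C1" "\<And>t. t \<le> 0 \<Longrightarrow> \<bar>\<Phi>\<^sub>1 t + a\<bar> \<le> C1 * exp (a * t)"
    "\<And>t. t \<le> 0 \<Longrightarrow> \<bar>P\<^sub>1 t\<bar> \<le> C1 * exp (a * t)" by (rule A.sharp_bounds) blast
  obtain C2 where C2: "0 < C2" "\<And>t. t \<le> 0 \<Longrightarrow> \<bar>P\<^sub>2 t\<bar> \<le> C2 * exp (a * t)"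
    by (rule B.sharp_bounds) blast
  define C where "C = C1 + C2"
  have C: "0 < C" "C1 \<le> C" "C2 \<le> C" using C1(1) C2(1) by (auto simp: C_def)
  have Phi1: "\<bar>\<Phi>\<^sub>1 t + a\<bar> \<le> C * exp (a * t)" if "t \<le> 0" for t
    by (rule order_trans[OF C1(2)[OF that] mult_right_mono[OF C(2)]]) simp
  have P1: "\<bar>P\<^sub>1 t\<bar> \<le> C * exp (a * t)" if "t \<le> 0" for t
    by (rule order_trans[OF C1(3)[OF that] mult_right_mono[OF C(2)]]) simp
  have P2: "\<bar>P\<^sub>2 t\<bar> \<le> C * exp (a * t)" if "t \<le> 0" for t
    by (rule order_trans[OF C2(2)[OF that] mult_right_mono[OF C(3)]]) simp
  define B where "B = C * (3 / a + 1)"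
  \<comment> \<open>\<open>B\<close> is the Lipschitz constant of the equation in the weighted norm, and this \<open>K\<close> makes the map a contraction with factor \<open>1/2\<close>.\<close>
  define K where "K = 2 * B / a"
  have K: "0 < K" "a * K / 2 = B" using a C(1) by (auto simp: K_def B_def field_simps add_pos_pos)
  define w where "w = (\<lambda>t. exp (a * t) * exp (K * exp (a * t)))"
  have w_pos: "0 < w t" for t by (simp add: w_def)
  have w_ge: "exp (a * t) \<le> w t" for t using K(1) by (simp add: w_def)
  have w_deriv: "has_deriv_half_line (\<lambda>t. E * w t) (\<lambda>t. E * ((a + K * a * exp (a * t)) * w t))" for E
    unfolding w_def by (auto intro!: derivative_eq_intros simp: algebra_simps)
  have ew_deriv: "has_deriv_half_line (\<lambda>t. E * (exp (a * t) * w t))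
      (\<lambda>t. E * ((2 * a + K * a * exp (a * t)) * (exp (a * t) * w t)))" for E
    unfolding w_def by (auto intro!: derivative_eq_intros simp: algebra_simps)
  have e_lim: "((\<lambda>t. exp (a * t)) \<longlongrightarrow> 0) at_bot" by (rule exp_scaled_at_bot[OF a])
  have w_lim: "((\<lambda>t. E * w t) \<longlongrightarrow> E * (0 * exp (K * 0))) at_bot" for E
    unfolding w_def by (intro tendsto_intros e_lim)
  have ew_lim: "((\<lambda>t. E * (exp (a * t) * w t)) \<longlongrightarrow> E * (0 * (0 * exp (K * 0)))) at_bot" for E
    unfolding w_def by (intro tendsto_intros e_lim)
  define p where "p = (\<lambda>t. P\<^sub>1 t - P\<^sub>2 t)"
  define D where "D = (\<lambda>t. \<Phi>\<^sub>1 t - \<Phi>\<^sub>2 t)"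
  have D_deriv: "has_deriv_half_line D p"
    unfolding D_def p_def by (rule deriv_half_line_diff[OF A.Phi_deriv B.Phi_deriv])
  have D_lim: "(D \<longlongrightarrow> 0) at_bot"
    unfolding D_def using tendsto_diff[OF A.limits_at_bot(1) B.limits_at_bot(1)] by simp
  have p_zero: "p t = 0" if "t \<in> {..0}" for t
  proof (rule half_iterated_bound_imp_zero[where x = p and w = w and M = "2 * C" and T = "{..0}"])
    fix t :: real assume "t \<in> {..0}"
    then have "\<bar>p t\<bar> \<le> 2 * C * exp (a * t)"
      using P1[of t] P2[of t] unfolding p_def by fastforce
    also have "\<dots> \<le> 2 * C * w t" using C(1) w_ge by (intro mult_left_mono) auto
    finally show "\<bar>p t\<bar> \<le> 2 * C * w t" .
  next
    fix E t :: real
    assume E: "0 \<le> E" and IH: "\<And>t. t \<in> {..0} \<Longrightarrow> \<bar>p t\<bar> \<le> E * w t" and t: "t \<in> {..0}"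
    have D_le: "\<bar>D t\<bar> \<le> E / a * w t" if "t \<le> 0" for t
    proof (rule abs_le_by_deriv[OF D_deriv w_deriv _ D_lim w_lim _ that])
      fix t :: real assume "t \<le> 0"
      then have "\<bar>p t\<bar> \<le> E * w t" using IH by simp
      also have "E * w t \<le> E / a * ((a + K * a * exp (a * t)) * w t)"
        using E a K(1) w_pos[of t] by (simp add: field_simps)
      finally show "\<bar>p t\<bar> \<le> E / a * ((a + K * a * exp (a * t)) * w t)" .
    qed simp
    have J_deriv: "has_deriv_half_line (\<lambda>t. A.energy t - B.energy t) (\<lambda>t. (P\<^sub>1 t)\<^sup>2 - (P\<^sub>2 t)\<^sup>2)"
      by (rule deriv_half_line_diff[OF A.energy_deriv B.energy_deriv])
    have J_lim: "((\<lambda>t. A.energy t - B.energy t) \<longlongrightarrow> 0) at_bot"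
      using tendsto_diff[OF A.energy_lim B.energy_lim] by simp
    have J_le: "\<bar>A.energy t - B.energy t\<bar> \<le> C * E / a * (exp (a * t) * w t)" if "t \<le> 0" for t
    proof (rule abs_le_by_deriv[OF J_deriv ew_deriv _ J_lim ew_lim _ that])
      fix t :: real assume t: "t \<le> 0"
      have "\<bar>(P\<^sub>1 t)\<^sup>2 - (P\<^sub>2 t)\<^sup>2\<bar> = \<bar>P\<^sub>1 t + P\<^sub>2 t\<bar> * \<bar>p t\<bar>"
        unfolding p_def abs_mult[symmetric] by (simp add: power2_eq_square algebra_simps)
      also have "\<dots> \<le> (2 * C * exp (a * t)) * (E * w t)"
        using P1[OF t] P2[OF t] IH[of t] t C(1) by (intro mult_mono) auto
      also have "\<dots> \<le> C * E / a * ((2 * a + K * a * exp (a * t)) * (exp (a * t) * w t))"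
        using E a K(1) C(1) w_pos[of t] by (simp add: field_simps)
      finally show "\<bar>(P\<^sub>1 t)\<^sup>2 - (P\<^sub>2 t)\<^sup>2\<bar> \<le> C * E / a * ((2 * a + K * a * exp (a * t)) * (exp (a * t) * w t))" .
    qed simp
    define q where "q = (\<lambda>t. P\<^sub>1 t * exp (- a * t) - P\<^sub>2 t * exp (- a * t))"
    define q' where "q' = (\<lambda>t. (c * A.energy t - (\<Phi>\<^sub>1 t + a) * P\<^sub>1 t) * exp (- a * t)
      - (c * B.energy t - (\<Phi>\<^sub>2 t + a) * P\<^sub>2 t) * exp (- a * t))"
    have q_deriv: "has_deriv_half_line q q'"
      unfolding q_def q'_def by (rule deriv_half_line_diff[OF A.scaled_P_deriv B.scaled_P_deriv])
    have q_lim: "(q \<longlongrightarrow> 0) at_bot"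
      unfolding q_def using tendsto_diff[OF A.amplitude_lim B.amplitude_lim] amp by simp
    have h_deriv: "has_deriv_half_line (\<lambda>t. E / 2 * exp (K * exp (a * t))) (\<lambda>t. E * B * w t)"
    proof (intro allI impI)
      fix t :: real
      show "((\<lambda>t. E / 2 * exp (K * exp (a * t))) has_real_derivative E * B * w t) (at t within {..0})"
        unfolding w_def K(2)[symmetric] by (auto intro!: derivative_eq_intros)
    qed
    have h_lim: "((\<lambda>t. E / 2 * exp (K * exp (a * t))) \<longlongrightarrow> E / 2 * exp (K * 0)) at_bot"
      by (intro tendsto_intros e_lim) 
    have "\<bar>q t\<bar> \<le> E / 2 * exp (K * exp (a * t))"
    proof (rule abs_le_by_deriv[OF q_deriv h_deriv _ q_lim h_lim])
      fix t :: real assume t: "t \<le> 0"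
      have q': "q' t = (c * (A.energy t - B.energy t) - (\<Phi>\<^sub>1 t + a) * p t - D t * P\<^sub>2 t) * exp (- a * t)"
        unfolding q'_def p_def D_def by (simp add: algebra_simps)
      have 1: "\<bar>c * (A.energy t - B.energy t)\<bar> \<le> 2 * (C * E / a * (exp (a * t) * w t))"
        unfolding abs_mult using J_le[OF t] A.c_nonneg A.c_le_2 by (intro mult_mono) auto
      have 2: "\<bar>(\<Phi>\<^sub>1 t + a) * p t\<bar> \<le> (C * exp (a * t)) * (E * w t)"
        unfolding abs_mult using Phi1[OF t] IH[of t] t C(1) by (intro mult_mono) auto
      have 3: "\<bar>D t * P\<^sub>2 t\<bar> \<le> (E / a * w t) * (C * exp (a * t))"
        unfolding abs_mult using D_le[OF t] P2[OF t] E a w_pos[of t] by (intro mult_mono) auto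
      have "\<bar>c * (A.energy t - B.energy t) - (\<Phi>\<^sub>1 t + a) * p t - D t * P\<^sub>2 t\<bar>
          \<le> 2 * (C * E / a * (exp (a * t) * w t)) + (C * exp (a * t)) * (E * w t) + (E / a * w t) * (C * exp (a * t))"
        using 1 2 3 by linarith
      also have "\<dots> = E * B * w t * exp (a * t)" by (simp add: B_def field_simps)
      finally have "\<bar>q' t\<bar> \<le> E * B * w t * exp (a * t) * exp (- a * t)"
        unfolding q' abs_mult by (simp add: mult_right_mono)
      then show "\<bar>q' t\<bar> \<le> E * B * w t" by (simp add: mult.assoc flip: exp_add)
    qed (use E t in auto)
    then have "\<bar>q t\<bar> * exp (a * t) \<le> E / 2 * exp (K * exp (a * t)) * exp (a * t)"
      by (intro mult_right_mono) auto
    moreover have "p t = q t * exp (a * t)"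
      unfolding p_def q_def by (simp add: algebra_simps flip: exp_add)
    ultimately show "\<bar>p t\<bar> \<le> E / 2 * w t" by (simp add: w_def abs_mult mult_ac)
  qed (use C that in auto)
  have "has_deriv_half_line D (\<lambda>_. 0)" using D_deriv p_zero by fastforce
  from constant_of_deriv_zero_at_bot[OF this D_lim t] show ?thesis by (simp add: D_def)
qed

section \<open>The sign of the amplitude\<close>

context decaying_solution
begin

text \<open>
  An integrating factor \<open>exp K\<close> with \<open>K' = \<Phi> + a\<close>, normalised to tend to
  \<open>1\<close> at minus infinity, makes \<open>y exp K\<close> nondecreasing and leaves the limit of
  \<open>y\<close> unchanged.
\<close>

lemma supersolution_nonneg:
  assumes y: "has_deriv_half_line y y'" and ge: "\<And>t. t \<le> 0 \<Longrightarrow> - (\<Phi> t + a) * y t \<le> y' t"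
    and lim: "(y \<longlongrightarrow> l) at_bot" and t: "t \<le> 0"
  shows "0 \<le> l \<Longrightarrow> 0 \<le> y t" and "0 < l \<Longrightarrow> 0 < y t"
proof -
  obtain C where C: "\<And>t. t \<le> 0 \<Longrightarrow> \<bar>\<Phi> t + a\<bar> \<le> C * exp (a * t)"
    by (rule sharp_bounds) blast
  have "continuous_on {..0} (\<lambda>t. \<Phi> t + a)" by (intro continuous_intros Phi_cont)
  then obtain K where K: "has_deriv_half_line K (\<lambda>t. \<Phi> t + a)" "(K \<longlongrightarrow> 0) at_bot"
    by (rule primitive_vanishing_at_bot[OF _ a_pos C])
  have "has_deriv_half_line (\<lambda>t. y t * exp (K t)) (\<lambda>t. (y' t + (\<Phi> t + a) * y t) * exp (K t))"
  proof (intro allI impI)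
    fix t :: real assume t: "t \<le> 0"
    show "((\<lambda>t. y t * exp (K t)) has_real_derivative (y' t + (\<Phi> t + a) * y t) * exp (K t)) (at t within {..0})"
      by (rule derivative_eq_intros y[rule_format, OF t] K(1)[rule_format, OF t] refl)+
        (simp add: algebra_simps)
  qed
  moreover have "0 \<le> (y' t + (\<Phi> t + a) * y t) * exp (K t)" if "t \<le> 0" for t
    using ge[OF that] by (intro mult_nonneg_nonneg) (auto simp: algebra_simps)
  moreover have "((\<lambda>t. y t * exp (K t)) \<longlongrightarrow> l * exp 0) at_bot" by (intro tendsto_intros lim K)
  ultimately have "l * exp 0 \<le> y t * exp (K t)" using t by (rule limit_at_bot_le)
  then have *: "l \<le> y t * exp (K t)" by simp
  show "0 \<le> l \<Longrightarrow> 0 \<le> y t" "0 < l \<Longrightarrow> 0 < y t"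
    using * by (smt (verit) exp_gt_zero mult_nonneg_nonneg mult_neg_pos mult_eq_0_iff)+
qed

lemma P_pos:
  assumes "0 < amplitude" "t \<le> 0"
  shows "0 < P t"
proof -
  have "0 < P t * exp (- a * t)"
  proof (rule supersolution_nonneg(2)[OF scaled_P_deriv _ amplitude_lim assms(2,1)])
    fix t :: real assume t: "t \<le> 0"
    have "0 \<le> c * energy t * exp (- a * t)" using energy_nonneg[OF t] c_nonneg by simp
    then show "- (\<Phi> t + a) * (P t * exp (- a * t)) \<le> (c * energy t - (\<Phi> t + a) * P t) * exp (- a * t)"
      by (simp add: algebra_simps)
  qed
  then show ?thesis by (simp add: zero_less_mult_iff)
qed

lemma scaled_Q_lim: "((\<lambda>t. Q t * exp (- a * t)) \<longlongrightarrow> a * amplitude) at_bot"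
proof -
  obtain C where C: "\<And>t. t \<le> 0 \<Longrightarrow> \<bar>energy t\<bar> \<le> C * exp (2 * a * t)"
    by (rule sharp_bounds) blast
  have "\<bar>energy t * exp (- a * t)\<bar> \<le> C * exp (a * t)" if "t \<le> 0" for t
  proof -
    have "\<bar>energy t\<bar> * exp (- a * t) \<le> C * exp (2 * a * t) * exp (- a * t)"
      using C[OF that] by (intro mult_right_mono) auto
    then show ?thesis by (simp add: abs_mult mult.assoc flip: exp_add)
  qed
  then have E: "((\<lambda>t. energy t * exp (- a * t)) \<longlongrightarrow> 0) at_bot"
    by (rule null_at_bot_of_exp_bound[OF a_pos])
  have "((\<lambda>t. c * (energy t * exp (- a * t)) - \<Phi> t * (P t * exp (- a * t))) \<longlongrightarrow> c * 0 - (-a) * amplitude) at_bot"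
    by (intro tendsto_intros E limits_at_bot amplitude_lim)
  then have "((\<lambda>t. c * (energy t * exp (- a * t)) - \<Phi> t * (P t * exp (- a * t))) \<longlongrightarrow> a * amplitude) at_bot"
    by simp
  then show ?thesis
  proof (rule Lim_transform_eventually)
    show "\<forall>\<^sub>F t in at_bot. c * (energy t * exp (- a * t)) - \<Phi> t * (P t * exp (- a * t)) = Q t * exp (- a * t)"
    proof (rule eventually_at_bot_half_line[of 0])
      fix t :: real assume "t \<le> 0"
      from first_integral[OF this] have Qt: "Q t = c * energy t - \<Phi> t * P t" by simp
      show "c * (energy t * exp (- a * t)) - \<Phi> t * (P t * exp (- a * t)) = Q t * exp (- a * t)"
        unfolding Qt by (simp add: algebra_simps)
    qed
  qed
qed

text \<open>
  This is \<open>P P'' - (P')\<^sup>2\<close> with \<open>P''\<close> eliminated by the equation, that is,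
  \<open>P\<^sup>2 (Q / P)'\<close>.
\<close>

definition wronskian :: "real \<Rightarrow> real" where
  "wronskian t = (c - 1) * P t ^ 3 - \<Phi> t * P t * Q t - (Q t)\<^sup>2"

text \<open>
  The Wronskian satisfies the homogeneous equation \<open>W' = - \<Phi> W\<close> up to a term of known
  sign, since \<open>c \<le> 2\<close>.
\<close>

lemma wronskian_deriv:
  "has_deriv_half_line wronskian (\<lambda>t. - \<Phi> t * wronskian t - (2 - c) * (P t)\<^sup>2 * Q t)"
proof (intro allI impI)
  fix t :: real assume t: "t \<le> 0"
  show "(wronskian has_real_derivative - \<Phi> t * wronskian t - (2 - c) * (P t)\<^sup>2 * Q t) (at t within {..0})"
    unfolding wronskian_def[abs_def]
    by (rule derivative_eq_intros Phi_deriv[rule_format, OF t] P_deriv[rule_format, OF t]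
        Q_deriv[rule_format, OF t] refl)+
      (simp add: algebra_simps power2_eq_square power3_eq_cube)
qed

lemma scaled_wronskian_lim: "((\<lambda>t. wronskian t * exp (- a * t)) \<longlongrightarrow> 0) at_bot"
proof -
  have "((\<lambda>t. (c - 1) * (P t)\<^sup>2 * (P t * exp (- a * t)) - \<Phi> t * Q t * (P t * exp (- a * t))
      - Q t * (Q t * exp (- a * t))) \<longlongrightarrow>
      (c - 1) * 0\<^sup>2 * amplitude - (-a) * 0 * amplitude - 0 * (a * amplitude)) at_bot"
    by (intro tendsto_intros limits_at_bot amplitude_lim scaled_Q_lim)
  then show ?thesis
    by (simp add: wronskian_def[abs_def] algebra_simps power2_eq_square power3_eq_cube)
qed

text \<open>
  The factor \<open>\<sigma> = \<plusminus>1\<close> treats both signs of the amplitude at once. If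
  \<open>\<sigma> P > 0\<close> and \<open>\<sigma> Q \<ge> 0\<close>, then
  \<open>- \<sigma> W e\<^sup>-\<^sup>a\<^sup>t\<close> is a supersolution that vanishes at minus infinity,
  so \<open>\<sigma> Q / P\<close> is nonincreasing, and it starts from the limit
  \<open>\<sigma> a\<close>.
\<close>

lemma Q_le_aP:
  assumes amp: "amplitude \<noteq> 0" and \<sigma>: "\<sigma>\<^sup>2 = 1"
    and P: "\<And>t. t \<le> 0 \<Longrightarrow> 0 < \<sigma> * P t" and Q: "\<And>t. t \<le> 0 \<Longrightarrow> 0 \<le> \<sigma> * Q t" and t: "t \<le> 0"
  shows "Q t \<le> a * P t"
proof -
  define y where "y = (\<lambda>t. - \<sigma> * (wronskian t * exp (- a * t)))"
  define y' where "y' = (\<lambda>t. (- (\<Phi> t + a)) * y t + (2 - c) * (P t)\<^sup>2 * (\<sigma> * Q t) * exp (- a * t))"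
  have y: "has_deriv_half_line y y'"
  proof (intro allI impI)
    fix t :: real assume t: "t \<le> 0"
    show "(y has_real_derivative y' t) (at t within {..0})"
      unfolding y_def y'_def
      by (rule derivative_eq_intros wronskian_deriv[rule_format, OF t] refl)+
        (simp add: algebra_simps)
  qed
  have "(y \<longlongrightarrow> - \<sigma> * 0) at_bot"
    unfolding y_def by (intro tendsto_intros scaled_wronskian_lim)
  then have y_lim: "(y \<longlongrightarrow> 0) at_bot" by simp
  have y_nonneg: "0 \<le> y t" if "t \<le> 0" for t
  proof (rule supersolution_nonneg(1)[OF y _ y_lim that])
    fix t :: real assume t: "t \<le> 0"
    have "0 \<le> (2 - c) * (P t)\<^sup>2 * (\<sigma> * Q t) * exp (- a * t)"
      using c_le_2 Q[OF t] by (intro mult_nonneg_nonneg[of _ "exp _"] mult_nonneg_nonneg[of _ "\<sigma> * Q t"]) auto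
    then show "- (\<Phi> t + a) * y t \<le> y' t" by (simp add: y'_def)
  qed simp
  have W: "\<sigma> * wronskian t \<le> 0" if "t \<le> 0" for t
  proof -
    have "0 \<le> (- (\<sigma> * wronskian t)) * exp (- a * t)"
      using y_nonneg[OF that] by (simp add: y_def)
    then show ?thesis by (simp only: zero_le_mult_iff exp_ge_zero) simp
  qed
  have P0: "P t \<noteq> 0" if "t \<le> 0" for t using P[OF that] by auto
  \<comment> \<open>The sign is chosen so that \<open>R\<close> is nondecreasing.\<close>
  define R where "R = (\<lambda>t. - \<sigma> * (Q t / P t))"
  have R: "has_deriv_half_line R (\<lambda>t. - (\<sigma> * wronskian t) / (P t)\<^sup>2)"
  proof (intro allI impI)
    fix t :: real assume t: "t \<le> 0"
    show "(R has_real_derivative - (\<sigma> * wronskian t) / (P t)\<^sup>2) (at t within {..0})"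
      unfolding R_def
      by (rule derivative_eq_intros P_deriv[rule_format, OF t] Q_deriv[rule_format, OF t] P0[OF t] refl)+
        (simp add: wronskian_def algebra_simps power2_eq_square power3_eq_cube
          diff_divide_distrib add_divide_distrib)
  qed
  have "((\<lambda>t. - \<sigma> * ((Q t * exp (- a * t)) / (P t * exp (- a * t)))) \<longlongrightarrow> - \<sigma> * (a * amplitude / amplitude)) at_bot"
    by (intro tendsto_intros amplitude_lim scaled_Q_lim amp)
  then have R_lim: "(R \<longlongrightarrow> - \<sigma> * a) at_bot" using amp by (simp add: R_def)
  have "- \<sigma> * a \<le> R t"
  proof (rule limit_at_bot_le[OF R _ R_lim t])
    fix t :: real assume "t \<le> 0"
    from W[OF this] show "0 \<le> - (\<sigma> * wronskian t) / (P t)\<^sup>2"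
      by (intro divide_nonneg_nonneg) auto
  qed
  then have "- \<sigma> * a * (\<sigma> * P t) \<le> R t * (\<sigma> * P t)"
    using P[OF t] by (intro mult_right_mono) auto
  also have "R t * (\<sigma> * P t) = - (\<sigma>\<^sup>2) * Q t"
    using P0[OF t] by (simp add: R_def power2_eq_square)
  also have "- \<sigma> * a * (\<sigma> * P t) = - (\<sigma>\<^sup>2) * (a * P t)" by (simp add: power2_eq_square)
  finally show ?thesis using \<sigma> by simp
qed

lemma scaled_negative_near_bot:
  assumes "((\<lambda>t. f t * exp (- a * t)) \<longlongrightarrow> l) at_bot" "l < 0"
  obtains T where "T \<le> s" "\<And>t. t \<le> T \<Longrightarrow> f t < 0"
proof -
  have "eventually (\<lambda>t. f t * exp (- a * t) < 0) at_bot" by (rule order_tendstoD(2)[OF assms])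
  then obtain T where T: "\<And>t. t \<le> T \<Longrightarrow> f t * exp (- a * t) < 0"
    by (auto simp: eventually_at_bot_linorder)
  then have "f t < 0" if "t \<le> T" for t using T[OF that] by (simp add: mult_less_0_iff)
  then show ?thesis using that[of "min s T"] by simp
qed

lemma P_neg_of_Q_nonpos:
  assumes amp: "amplitude < 0" and Q: "\<And>t. t \<le> 0 \<Longrightarrow> Q t \<le> 0" and t: "t \<le> 0"
  shows "P t < 0"
proof -
  obtain T where T: "T \<le> t" "\<And>s. s \<le> T \<Longrightarrow> P s < 0"
    using scaled_negative_near_bot[OF amplitude_lim amp, of t] by blast
  have "has_deriv_half_line (\<lambda>t. - P t) (\<lambda>t. - Q t)" using P_deriv by (auto intro: DERIV_minus)
  from deriv_nonneg_imp_le[OF this _ T(1) t] Q have "- P T \<le> - P t" by auto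
  then show ?thesis using T(2)[of T] by simp
qed

lemma Q_neg_of_Q_nonpos:
  assumes amp: "amplitude < 0" and Q: "\<And>t. t \<le> 0 \<Longrightarrow> Q t \<le> 0" and t: "t \<le> 0"
  shows "Q t < 0"
proof -
  have "Q t \<le> a * P t"
    by (rule Q_le_aP[of "-1"]) (use amp Q t P_neg_of_Q_nonpos[OF amp Q] in auto)
  also have "\<dots> < 0" using P_neg_of_Q_nonpos[OF amp Q t] a_pos by (simp add: mult_pos_neg)
  finally show ?thesis .
qed

text \<open>
  The equation is autonomous, so the restriction of a solution to \<open>{..s}\<close> becomes a solution on
  \<open>{..0}\<close>.
\<close>

lemma shift:
  assumes s: "s \<le> 0"
  shows "decaying_solution a c (\<lambda>t. \<Phi> (t + s)) (\<lambda>t. P (t + s)) (\<lambda>t. Q (t + s))"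
    and "decaying_solution.amplitude a (\<lambda>t. P (t + s)) = exp (a * s) * amplitude"
proof -
  have translate: "has_deriv_half_line (\<lambda>t. f (t + s)) (\<lambda>t. f' (t + s))"
    if f: "has_deriv_half_line f f'" for f f'
  proof (intro allI impI)
    fix t :: real assume "t \<le> 0"
    then have "(f has_real_derivative f' (t + s)) (at (t + s) within {..0})" using f s by auto
    then have "(f has_real_derivative f' (t + s)) (at (t + s) within (\<lambda>t. t + s) ` {..0})"
      by (rule DERIV_subset) (use s in auto)
    moreover have "((\<lambda>t. t + s) has_real_derivative 1) (at t within {..0})"
      by (auto intro!: derivative_eq_intros)
    ultimately have "(f \<circ> (\<lambda>t. t + s) has_real_derivative f' (t + s) * 1) (at t within {..0})"
      by (rule DERIV_image_chain)
    then show "((\<lambda>t. f (t + s)) has_real_derivative f' (t + s)) (at t within {..0})"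
      by (simp add: o_def)
  qed
  have lim: "filterlim (\<lambda>t. t + s) at_bot at_bot"
    unfolding filterlim_at_bot eventually_at_bot_linorder by (metis add.commute le_diff_eq)
  have decay': "((\<lambda>t. exp (- \<epsilon> * t) * f (t + s)) \<longlongrightarrow> 0) at_bot"
    if "((\<lambda>t. exp (- \<epsilon> * t) * f t) \<longlongrightarrow> 0) at_bot" for f :: "real \<Rightarrow> real" and \<epsilon>
  proof -
    have "((\<lambda>t. exp (\<epsilon> * s) * (exp (- \<epsilon> * (t + s)) * f (t + s))) \<longlongrightarrow> exp (\<epsilon> * s) * 0) at_bot"
      by (intro tendsto_intros filterlim_compose[OF that lim])
    moreover have "exp (\<epsilon> * s) * (exp (- \<epsilon> * (t + s)) * f (t + s)) = exp (- \<epsilon> * t) * f (t + s)" for t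
      by (simp add: algebra_simps flip: exp_add mult.assoc)
    ultimately show ?thesis by (simp only: mult_zero_right)
  qed
  interpret S: decaying_solution a c "\<lambda>t. \<Phi> (t + s)" "\<lambda>t. P (t + s)" "\<lambda>t. Q (t + s)"
    by unfold_locales
      (fact a_pos c_nonneg c_le_2 translate[OF Phi_deriv] translate[OF P_deriv] translate[OF Q_deriv] 
        decay'[OF decay(1)] decay'[OF decay(2)] decay'[OF decay(3)])+
  show "decaying_solution a c (\<lambda>t. \<Phi> (t + s)) (\<lambda>t. P (t + s)) (\<lambda>t. Q (t + s))" ..
  have "((\<lambda>t. exp (a * s) * (P (t + s) * exp (- a * (t + s)))) \<longlongrightarrow> exp (a * s) * amplitude) at_bot"
    by (intro tendsto_intros filterlim_compose[OF amplitude_lim lim])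
  moreover have "exp (a * s) * (P (t + s) * exp (- a * (t + s))) = P (t + s) * exp (- a * t)" for t
    by (simp add: algebra_simps flip: exp_add mult.assoc)
  ultimately have "((\<lambda>t. P (t + s) * exp (- a * t)) \<longlongrightarrow> exp (a * s) * amplitude) at_bot"
    by (simp only:)
  then show "S.amplitude = exp (a * s) * amplitude"
    using tendsto_unique[OF trivial_limit_at_bot_linorder S.amplitude_lim] by simp
qed

text \<open>
  Near minus infinity \<open>Q\<close> is negative. If it had a zero, the first one could be moved to the
  origin, where it contradicts the bound \<open>Q \<le> a P < 0\<close> that holds while
  \<open>Q \<le> 0\<close>.
\<close>

lemma Q_neg:
  assumes amp: "amplitude < 0" and t: "t \<le> 0"
  shows "Q t < 0"
proof (rule ccontr)
  assume "\<not> Q t < 0"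
  have "((\<lambda>t. Q t * exp (- a * t)) \<longlongrightarrow> a * amplitude) at_bot" by (rule scaled_Q_lim)
  moreover have "a * amplitude < 0" using amp a_pos by (simp add: mult_pos_neg)
  ultimately obtain T where T: "T \<le> t" "\<And>s. s \<le> T \<Longrightarrow> Q s < 0"
    using scaled_negative_near_bot[of Q "a * amplitude" t] by blast
  have zero: "\<exists>x\<in>{T..u}. Q x = 0" if "T \<le> u" "u \<le> 0" "0 \<le> Q u" for u
  proof -
    have "\<exists>x\<ge>T. x \<le> u \<and> Q x = 0"
      using T(2)[of T] that continuous_on_subset[OF Q_cont] by (intro IVT') auto
    then show ?thesis by auto
  qed
  define Z where "Z = {x\<in>{T..0}. Q x = 0}"
  have "closed Z"
    unfolding Z_def using continuous_on_subset[OF Q_cont, of "{T..0}"]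
    by (intro continuous_closed_preimage_constant) auto
  moreover have "bounded Z" unfolding Z_def by (rule bounded_subset[of "{T..0}"]) auto
  ultimately have Z: "compact Z" by (simp add: compact_eq_bounded_closed)
  have "Z \<noteq> {}"
  proof -
    obtain x where "x \<in> {T..t}" "Q x = 0"
      using zero[OF T(1) t] \<open>\<not> Q t < 0\<close> by (auto simp: not_less)
    then have "x \<in> Z" using t by (simp add: Z_def)
    then show ?thesis by blast
  qed
  from compact_attains_inf[OF Z this] obtain z where z: "z \<in> Z" "\<And>x. x \<in> Z \<Longrightarrow> z \<le> x"
    by auto
  have z0: "z \<le> 0" "Q z = 0" using z(1) by (auto simp: Z_def)
  have neg: "Q x \<le> 0" if "x \<le> z" for x
  proof (rule ccontr)
    assume pos: "\<not> Q x \<le> 0"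
    then have "T \<le> x" using T(2)[of x] by linarith
    moreover have "x \<le> 0" "0 \<le> Q x" using pos that z0 by auto
    ultimately obtain x' where x': "x' \<in> {T..x}" "Q x' = 0" using zero by blast
    then have "x' \<in> Z" using \<open>x \<le> 0\<close> by (simp add: Z_def)
    from z(2)[OF this] x'(1) that have "x = z" by simp
    with pos z0 show False by simp
  qed
  interpret S: decaying_solution a c "\<lambda>t. \<Phi> (t + z)" "\<lambda>t. P (t + z)" "\<lambda>t. Q (t + z)"
    by (rule shift(1)[OF z0(1)])
  have "S.amplitude < 0" using shift(2)[OF z0(1)] amp by (simp add: mult_pos_neg)
  from S.Q_neg_of_Q_nonpos[OF this, of 0] neg z0 show False by simp
qed

text \<open>
  With amplitude zero the solution is the constant \<open>- a\<close>; with negative amplitude it decreases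
  from \<open>- a\<close>. Neither reaches \<open>0\<close>.
\<close>

lemma amplitude_pos:
  assumes "\<Phi> 0 = 0"
  shows "0 < amplitude"
proof (rule ccontr)
  assume "\<not> 0 < amplitude"
  then consider "amplitude = 0" | "amplitude < 0" by linarith
  then show False
  proof cases
    case 1
    interpret Z: decaying_solution a c "\<lambda>_. - a" "\<lambda>_. 0" "\<lambda>_. 0"
      by unfold_locales (auto simp: a_pos c_nonneg c_le_2)
    have "Z.amplitude = 0" unfolding Z.amplitude_def by (simp add: tendsto_Lim)
    with 1 have "\<Phi> 0 = - a"
      by (intro same_amplitude_imp_equal[OF decaying_solution_axioms Z.decaying_solution_axioms]) auto
    with assms a_pos show False by simp
  next
    case 2
    have "has_deriv_half_line (\<lambda>t. - \<Phi> t) (\<lambda>t. - P t)" using Phi_deriv by (auto intro: DERIV_minus)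
    moreover have "P t < 0" if "t \<le> 0" for t
      using P_neg_of_Q_nonpos[OF 2 _ that] Q_neg[OF 2] less_imp_le by blast
    ultimately have "- (- a) \<le> - \<Phi> 0"
      by (intro limit_at_bot_le[OF _ _ tendsto_minus[OF limits_at_bot(1)]]) (auto intro: less_imp_le)
    with assms a_pos show False by simp
  qed
qed

end

section \<open>Integral identities, convexity and the two bounds\<close>

lemma tangent_below:
  assumes f: "has_deriv_half_line f f'" and mono: "\<And>s t. s \<le> t \<Longrightarrow> t \<le> 0 \<Longrightarrow> f' s \<le> f' t"
    and x: "x \<le> 0" and z: "z \<le> 0"
  shows "f z + f' z * (x - z) \<le> f x"
proof -
  have mvt: "\<exists>w. s < w \<and> w < t \<and> f t - f s = (t - s) * f' w" if st: "s < t" "t \<le> 0" for s t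
  proof -
    have der: "DERIV f w :> f' w" if "s < w" "w < t" for w
      using f[rule_format, of w] at_within_half_line[of w] that st by simp
    then have "\<exists>l w. s < w \<and> w < t \<and> DERIV f w :> l \<and> f t - f s = (t - s) * l"
      using st continuous_on_subset[OF deriv_half_line_imp_continuous_on[OF f], of "{s..t}"]
      by (intro MVT) (auto intro: differentiableI simp: real_differentiable_def)
    then show ?thesis using der DERIV_unique by blast
  qed
  consider "x = z" | "x < z" | "z < x" by linarith
  then show ?thesis
  proof cases
    case 2
    from mvt[OF 2 z] obtain w where w: "x < w" "w < z" "f z - f x = (z - x) * f' w" by blast
    have "(z - x) * f' w \<le> (z - x) * f' z" using 2 w mono[of w z] z by (intro mult_left_mono) auto
    with w(3) show ?thesis by (simp add: algebra_simps)
  next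
    case 3
    from mvt[OF 3 x] obtain w where w: "z < w" "w < x" "f x - f z = (x - z) * f' w" by blast
    have "(x - z) * f' z \<le> (x - z) * f' w" using 3 w mono[of z w] x by (intro mult_left_mono) auto
    with w(3) show ?thesis by (simp add: algebra_simps)
  qed simp
qed

lemma convex_on_half_line:
  assumes f: "has_deriv_half_line f f'" and mono: "\<And>s t. s \<le> t \<Longrightarrow> t \<le> 0 \<Longrightarrow> f' s \<le> f' t"
  shows "convex_on {..0} f"
proof (rule convex_onI)
  fix t x y :: real
  assume t: "0 < t" "t < 1" and xy: "x \<in> {..0}" "y \<in> {..0}"
  define z where "z = (1 - t) *\<^sub>R x + t *\<^sub>R y"
  have "z \<in> {..0}" unfolding z_def using convexD_alt[of "{..0::real}" x y t] t xy by simp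
  then have z: "z \<le> 0" by simp
  have "f z = (1 - t) * (f z + f' z * (x - z)) + t * (f z + f' z * (y - z))"
    by (simp add: z_def algebra_simps)
  also have "\<dots> \<le> (1 - t) * f x + t * f y"
    using tangent_below[OF f mono _ z] xy t by (intro add_mono mult_left_mono) auto
  finally show "f ((1 - t) *\<^sub>R x + t *\<^sub>R y) \<le> (1 - t) * f x + t * f y" by (simp add: z_def)
qed simp

context decaying_solution
begin

definition double_energy :: "real \<Rightarrow> real" where
  "double_energy t = integral {..t} energy"

lemmas energy_cont = deriv_half_line_imp_continuous_on[OF energy_deriv]

lemma double_energy_deriv: "has_deriv_half_line double_energy energy"
  and double_energy_lim: "(double_energy \<longlongrightarrow> 0) at_bot"
proof -
  obtain C where C: "\<And>t. t \<le> 0 \<Longrightarrow> \<bar>energy t\<bar> \<le> C * exp (2 * a * t)"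
    by (rule sharp_bounds) blast
  have "0 < 2 * a" using a_pos by simp
  note tail = tail_integral_primitive[OF energy_cont this, of C, folded double_energy_def]
  show "has_deriv_half_line double_energy energy" by (rule tail(1)) (rule C)
  show "(double_energy \<longlongrightarrow> 0) at_bot" by (rule tail(2)) (rule C)
qed

lemma double_energy_nonneg: "t \<le> 0 \<Longrightarrow> 0 \<le> double_energy t"
  by (rule limit_at_bot_le[OF double_energy_deriv energy_nonneg double_energy_lim])

text \<open>
  The first integral says that the two sides have the same derivative, and both vanish at minus infinity.
\<close>

lemma second_integral: 
  assumes t: "t \<le> 0"
  shows "P t = (a\<^sup>2 - (\<Phi> t)\<^sup>2) / 2 + c * double_energy t"
proof -
  have "has_deriv_half_line (\<lambda>t. P t - 1 / 2 * (a\<^sup>2 - (\<Phi> t)\<^sup>2) - c * double_energy t) (\<lambda>_. 0)"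
  proof (intro allI impI)
    fix t :: real assume t: "t \<le> 0"
    show "((\<lambda>t. P t - 1 / 2 * (a\<^sup>2 - (\<Phi> t)\<^sup>2) - c * double_energy t) has_real_derivative 0) (at t within {..0})"
      by (rule derivative_eq_intros Phi_deriv[rule_format, OF t] P_deriv[rule_format, OF t]
          double_energy_deriv[rule_format, OF t] refl)+
         (use first_integral[OF t] in \<open>simp add: algebra_simps\<close>)
  qed
  moreover have "((\<lambda>t. P t - 1 / 2 * (a\<^sup>2 - (\<Phi> t)\<^sup>2) - c * double_energy t)
      \<longlongrightarrow> 0 - 1 / 2 * (a\<^sup>2 - (- a)\<^sup>2) - c * 0) at_bot"
    by (intro tendsto_intros limits_at_bot double_energy_lim)
  ultimately have "P t - 1 / 2 * (a\<^sup>2 - (\<Phi> t)\<^sup>2) - c * double_energy t = 0 - 1 / 2 * (a\<^sup>2 - (- a)\<^sup>2) - c * 0"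
    using t by (rule constant_of_deriv_zero_at_bot)
  then show ?thesis by simp
qed

text \<open>
  A linear factor costs half of the exponential rate, because
  \<open>- s \<le> e\<^sup>-\<^sup>a\<^sup>s / a\<close>.
\<close>

lemma linear_weight_bound:
  assumes x: "\<bar>x\<bar> \<le> C * exp (2 * a * s)" and s: "s \<le> 0"
  shows "\<bar>(\<tau> - s) * x\<bar> \<le> C * (\<bar>\<tau>\<bar> + 1 / a) * exp (a * s)"
proof -
  have "1 + (- a * s) \<le> exp (- a * s)" by (rule exp_ge_add_one_self)
  then have "- s \<le> 1 / a * exp (- a * s)" using a_pos by (simp add: field_simps)
  moreover have "\<bar>\<tau>\<bar> * 1 \<le> \<bar>\<tau>\<bar> * exp (- a * s)"
    using a_pos s by (intro mult_left_mono) (auto simp: mult_nonneg_nonpos)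
  ultimately have "\<bar>\<tau> - s\<bar> \<le> (\<bar>\<tau>\<bar> + 1 / a) * exp (- a * s)"
    using s by (simp add: algebra_simps)
  then have "\<bar>(\<tau> - s) * x\<bar> \<le> (\<bar>\<tau>\<bar> + 1 / a) * exp (- a * s) * (C * exp (2 * a * s))"
    unfolding abs_mult using x a_pos by (intro mult_mono) auto
  also have "\<dots> = C * (\<bar>\<tau>\<bar> + 1 / a) * (exp (- a * s) * exp (2 * a * s))" by simp
  also have "exp (- a * s) * exp (2 * a * s) = exp (a * s)" by (simp flip: exp_add)
  finally show ?thesis .
qed

lemma sharp_P_square_bound:
  obtains C where "\<And>t. t \<le> 0 \<Longrightarrow> \<bar>(P t)\<^sup>2\<bar> \<le> C * exp (2 * a * t)"
proof -
  obtain C where "\<And>t. t \<le> 0 \<Longrightarrow> \<bar>P t\<bar> \<le> C * exp (a * t)" by (rule sharp_bounds) blast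
  from square_le_exp[OF this] show ?thesis using that by blast
qed

lemma energy_has_integral:
  assumes \<tau>: "\<tau> \<le> 0"
  shows "((\<lambda>t. (P t)\<^sup>2) has_integral energy \<tau>) {..\<tau>}"
proof -
  obtain C where C: "\<And>t. t \<le> 0 \<Longrightarrow> \<bar>(P t)\<^sup>2\<bar> \<le> C * exp (2 * a * t)"
    by (rule sharp_P_square_bound) blast
  show ?thesis
    by (rule has_integral_atMost_of_primitive[OF energy_deriv energy_lim P_square_cont _ C \<tau>])
      (use a_pos in auto)
qed

text \<open>
  Integration by parts: \<open>(\<tau> - s) energy s + double_energy s\<close> is a primitive of the
  weighted integrand.
\<close>

lemma double_energy_has_integral:
  assumes \<tau>: "\<tau> \<le> 0"
  shows "((\<lambda>s. (\<tau> - s) * (P s)\<^sup>2) has_integral double_energy \<tau>) {..\<tau>}"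
proof -
  obtain C where C: "\<And>t. t \<le> 0 \<Longrightarrow> \<bar>(P t)\<^sup>2\<bar> \<le> C * exp (2 * a * t)"
    by (rule sharp_P_square_bound) blast
  obtain C' where C': "\<And>t. t \<le> 0 \<Longrightarrow> \<bar>energy t\<bar> \<le> C' * exp (2 * a * t)"
    by (rule sharp_bounds) blast
  define G where "G = (\<lambda>s. (\<tau> - s) * energy s + double_energy s)"
  have G: "has_deriv_half_line G (\<lambda>s. (\<tau> - s) * (P s)\<^sup>2)"
  proof (intro allI impI)
    fix s :: real assume s: "s \<le> 0"
    show "(G has_real_derivative (\<tau> - s) * (P s)\<^sup>2) (at s within {..0})"
      unfolding G_def
      by (rule derivative_eq_intros energy_deriv[rule_format, OF s]
          double_energy_deriv[rule_format, OF s] refl)+ simp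
  qed
  have "((\<lambda>s. (\<tau> - s) * energy s) \<longlongrightarrow> 0) at_bot"
    by (rule null_at_bot_of_exp_bound[OF a_pos linear_weight_bound[OF C']])
  from tendsto_add[OF this double_energy_lim] have G_lim: "(G \<longlongrightarrow> 0) at_bot" by (simp add: G_def)
  have "((\<lambda>s. (\<tau> - s) * (P s)\<^sup>2) has_integral G \<tau>) {..\<tau>}"
    by (rule has_integral_atMost_of_primitive[OF G G_lim _ a_pos linear_weight_bound[OF C] \<tau>])
      (intro continuous_intros P_cont)
  then show ?thesis by (simp add: G_def)
qed

lemma Phi_strict_mono: "0 < amplitude \<Longrightarrow> s < t \<Longrightarrow> t \<le> 0 \<Longrightarrow> \<Phi> s < \<Phi> t"
  using deriv_pos_imp_less[OF Phi_deriv] P_pos by blast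

text \<open>
  For \<open>\<Phi> t = a tanh (a t / 2)\<close>, the solution with \<open>c = 0\<close>, this is
  constantly \<open>1\<close>; in general it measures how far \<open>\<Phi>\<close> is ahead of that solution.
\<close>

definition tanh_ratio :: "real \<Rightarrow> real" where
  "tanh_ratio t = (\<Phi> t + a) / (a - \<Phi> t) * exp (- a * t)"

context
  assumes amp: "0 < amplitude" and Phi0: "\<Phi> 0 < a"
begin

lemma Phi_less_a: "t \<le> 0 \<Longrightarrow> \<Phi> t < a"
  using Phi_strict_mono[OF amp, of t 0] Phi0 by (cases "t = 0") auto

text \<open>
  Only the memory term \<open>c \<integral>\<integral> P\<^sup>2\<close> of the second integral survives,
  and it is nonnegative.
\<close>

lemma tanh_ratio_deriv:
  "has_deriv_half_line tanh_ratio (\<lambda>t. 2 * a * (c * double_energy t) / (a - \<Phi> t)\<^sup>2 * exp (- a * t))"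
proof (intro allI impI)
  fix t :: real assume t: "t \<le> 0"
  have ne: "a - \<Phi> t \<noteq> 0" using Phi_less_a[OF t] by simp
  have "(tanh_ratio has_real_derivative
      (P t * (a - \<Phi> t) + (\<Phi> t + a) * P t) / (a - \<Phi> t)\<^sup>2 * exp (- a * t) -
      a * ((\<Phi> t + a) / (a - \<Phi> t)) * exp (- a * t)) (at t within {..0})"
    unfolding tanh_ratio_def[abs_def]
    by (rule derivative_eq_intros Phi_deriv[rule_format, OF t] ne refl)+
      (simp add: power2_eq_square)
  moreover have "(P t * (a - \<Phi> t) + (\<Phi> t + a) * P t) / (a - \<Phi> t)\<^sup>2 * exp (- a * t) -
      a * ((\<Phi> t + a) / (a - \<Phi> t)) * exp (- a * t)
      = 2 * a * (c * double_energy t) / (a - \<Phi> t)\<^sup>2 * exp (- a * t)"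
  proof -
    have frac: "(\<Phi> t + a) / (a - \<Phi> t) = (\<Phi> t + a) * (a - \<Phi> t) / (a - \<Phi> t)\<^sup>2"
      using ne by (simp add: power2_eq_square)
    have "2 * P t = a\<^sup>2 - (\<Phi> t)\<^sup>2 + 2 * (c * double_energy t)"
      using second_integral[OF t] by simp
    then have "P t * (a - \<Phi> t) + (\<Phi> t + a) * P t - a * ((\<Phi> t + a) * (a - \<Phi> t)) = 2 * a * (c * double_energy t)"
      by algebra
    moreover have "x / D * e - a * (y / D) * e = (x - a * y) / D * e" for x y D e :: real
      by (simp add: algebra_simps diff_divide_distrib)
    ultimately show ?thesis unfolding frac by (simp only:)
  qed
  ultimately show "(tanh_ratio has_real_derivative
      2 * a * (c * double_energy t) / (a - \<Phi> t)\<^sup>2 * exp (- a * t)) (at t within {..0})"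
    by (simp only:)
qed

lemma tanh_ratio_mono: "s \<le> t \<Longrightarrow> t \<le> 0 \<Longrightarrow> tanh_ratio s \<le> tanh_ratio t"
  by (rule deriv_nonneg_imp_le[OF tanh_ratio_deriv])
    (use a_pos c_nonneg double_energy_nonneg in auto)

lemma tanh_ratio_lim: "(tanh_ratio \<longlongrightarrow> amplitude / (2 * a\<^sup>2)) at_bot"
proof -
  obtain C where C: "\<And>t. t \<le> 0 \<Longrightarrow> \<bar>energy t\<bar> \<le> C * exp (2 * a * t)"
    by (rule sharp_bounds) blast
  have D: "\<bar>double_energy t\<bar> \<le> C / (2 * a) * exp (2 * a * t)" if "t \<le> 0" for t
    by (rule abs_le_exp_of_deriv[OF double_energy_deriv _ C double_energy_lim that])
      (use a_pos in auto)
  have "\<bar>double_energy t * exp (- a * t)\<bar> \<le> C / (2 * a) * exp (a * t)" if "t \<le> 0" for t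
  proof -
    have "\<bar>double_energy t\<bar> * exp (- a * t) \<le> C / (2 * a) * exp (2 * a * t) * exp (- a * t)"
      using D[OF that] by (intro mult_right_mono) auto
    then show ?thesis by (simp add: abs_mult mult.assoc flip: exp_add)
  qed
  then have E: "((\<lambda>t. double_energy t * exp (- a * t)) \<longlongrightarrow> 0) at_bot"
    by (rule null_at_bot_of_exp_bound[OF a_pos])
  have "((\<lambda>t. 2 * (P t * exp (- a * t) - c * (double_energy t * exp (- a * t))) / (a - \<Phi> t)\<^sup>2)
      \<longlongrightarrow> 2 * (amplitude - c * 0) / (a - (- a))\<^sup>2) at_bot"
    using a_pos by (intro tendsto_intros E limits_at_bot amplitude_lim) auto
  moreover have "2 * (amplitude - c * 0) / (a - (- a))\<^sup>2 = amplitude / (2 * a\<^sup>2)"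
    by (simp add: power2_eq_square)
  ultimately have lim: "((\<lambda>t. 2 * (P t * exp (- a * t) - c * (double_energy t * exp (- a * t))) / (a - \<Phi> t)\<^sup>2)
      \<longlongrightarrow> amplitude / (2 * a\<^sup>2)) at_bot" by (simp only:)
  have "2 * (P t * exp (- a * t) - c * (double_energy t * exp (- a * t))) / (a - \<Phi> t)\<^sup>2 = tanh_ratio t"
    if t: "t \<le> 0" for t
  proof -
    have ne: "a - \<Phi> t \<noteq> 0" using Phi_less_a[OF t] by simp
    have "2 * (P t - c * double_energy t) = (\<Phi> t + a) * (a - \<Phi> t)"
    proof -
      have "2 * P t = a\<^sup>2 - (\<Phi> t)\<^sup>2 + 2 * (c * double_energy t)"
        using second_integral[OF t] by simp
      then show ?thesis by algebra
    qed
    then have "2 * (P t * exp (- a * t) - c * (double_energy t * exp (- a * t)))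
        = (\<Phi> t + a) * (a - \<Phi> t) * exp (- a * t)" by algebra
    then show ?thesis using ne by (simp add: tanh_ratio_def power2_eq_square)
  qed
  then show ?thesis
    by (intro Lim_transform_eventually[OF lim] eventually_at_bot_half_line[of 0]) blast
qed

text \<open>
  The quotient increases from its limit at minus infinity to its value at \<open>0\<close>. In the existence
  proof this forces a solution of large enough amplitude to have reached zero.
\<close>

lemma amplitude_le_endpoint: "amplitude / (2 * a\<^sup>2) \<le> (\<Phi> 0 + a) / (a - \<Phi> 0)"
proof -
  have "amplitude / (2 * a\<^sup>2) \<le> tanh_ratio 0"
    by (rule limit_at_bot_le[OF tanh_ratio_deriv _ tanh_ratio_lim])
      (use a_pos c_nonneg double_energy_nonneg in auto)
  then show ?thesis by (simp add: tanh_ratio_def)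
qed

end

context
  assumes anchored: "\<Phi> 0 = 0"
begin

lemma Phi_nonpos: "t \<le> 0 \<Longrightarrow> \<Phi> t \<le> 0"
  using Phi_strict_mono[OF amplitude_pos[OF anchored], of t 0] anchored by (cases "t = 0") auto

lemma Q_nonneg:
  assumes t: "t \<le> 0"
  shows "0 \<le> Q t"
proof -
  have "0 \<le> c * energy t" using c_nonneg energy_nonneg[OF t] by simp
  moreover have "\<Phi> t * P t \<le> 0"
    using Phi_nonpos[OF t] P_pos[OF amplitude_pos[OF anchored] t] by (simp add: mult_nonpos_nonneg)
  ultimately show ?thesis using first_integral[OF t] by linarith
qed

lemma convex: "convex_on {..0} \<Phi>"
  by (rule convex_on_half_line[OF Phi_deriv deriv_nonneg_imp_le[OF P_deriv Q_nonneg]])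

text \<open>
  The increasing quotient equals \<open>1\<close> at the origin, so it is at most \<open>1\<close> to the left
  of it.
\<close>

lemma tanh_upper_bound:
  assumes t: "t \<le> 0"
  shows "\<Phi> t \<le> a * tanh (a * t / 2)"
proof -
  have Phi0: "\<Phi> 0 < a" using anchored a_pos by simp
  note amp = amplitude_pos[OF anchored]
  have pos: "0 < a - \<Phi> t" using Phi_less_a[OF amp Phi0 t] by simp
  have "tanh_ratio t \<le> tanh_ratio 0" using tanh_ratio_mono[OF amp Phi0 t] by simp
  then have "(\<Phi> t + a) / (a - \<Phi> t) * exp (- a * t) * exp (a * t) \<le> 1 * exp (a * t)"
    using anchored a_pos unfolding tanh_ratio_def by (intro mult_right_mono) auto
  then have "(\<Phi> t + a) / (a - \<Phi> t) \<le> exp (a * t)" by (simp add: mult.assoc flip: exp_add)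
  then have "\<Phi> t + a \<le> exp (a * t) * (a - \<Phi> t)" using pos by (simp add: pos_divide_le_eq)
  then have *: "\<Phi> t * (exp (a * t) + 1) \<le> a * (exp (a * t) - 1)" by (simp add: algebra_simps)
  have "tanh (a * t / 2) = (exp (a * t) - 1) / (exp (a * t) + 1)"
  proof -
    have "tanh (a * t / 2) = (1 - inverse (exp (a * t))) / (1 + inverse (exp (a * t)))"
      using tanh_real_altdef[of "a * t / 2"] by (simp add: exp_minus)
    moreover have "(1 - inverse e) / (1 + inverse e) = (e - 1) / (e + 1)" if "0 < e" for e :: real
      using that by (simp add: divide_simps)
    ultimately show ?thesis by simp
  qed
  then show ?thesis using * by (simp add: pos_le_divide_eq add_pos_pos)
qed

text \<open>
  Integrating \<open>Q \<le> a P\<close> from minus infinity gives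
  \<open>P \<le> a (\<Phi> + a)\<close>, so \<open>(\<Phi> + a) e\<^sup>-\<^sup>a\<^sup>t\<close> is
  nonincreasing, and its value at the origin is \<open>a\<close>.
\<close>

lemma exp_lower_bound:
  assumes t: "t \<le> 0"
  shows "a * (exp (a * t) - 1) \<le> \<Phi> t"
proof -
  note amp = amplitude_pos[OF anchored]
  have Q_le: "Q t \<le> a * P t" if "t \<le> 0" for t
    by (rule Q_le_aP[of 1]) (use amp P_pos[OF amp] Q_nonneg that in auto)
  have P_le: "P t \<le> a * (\<Phi> t + a)" if "t \<le> 0" for t
  proof -
    have d: "has_deriv_half_line (\<lambda>t. a * (\<Phi> t + a) - P t) (\<lambda>t. a * P t - Q t)"
    proof (intro allI impI)
      fix t :: real assume t: "t \<le> 0"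
      show "((\<lambda>t. a * (\<Phi> t + a) - P t) has_real_derivative a * P t - Q t) (at t within {..0})"
        by (rule derivative_eq_intros Phi_deriv[rule_format, OF t] P_deriv[rule_format, OF t] refl)+ simp
    qed
    have l: "((\<lambda>t. a * (\<Phi> t + a) - P t) \<longlongrightarrow> a * (- a + a) - 0) at_bot"
      by (intro tendsto_intros limits_at_bot)
    have "a * (- a + a) - 0 \<le> a * (\<Phi> t + a) - P t"
      by (rule limit_at_bot_le[OF d _ l that]) (use Q_le in auto)
    then show ?thesis by simp
  qed
  have "has_deriv_half_line (\<lambda>t. - (\<Phi> t + a) * exp (- a * t)) (\<lambda>t. (a * (\<Phi> t + a) - P t) * exp (- a * t))"
  proof (intro allI impI)
    fix t :: real assume t: "t \<le> 0"
    show "((\<lambda>t. - (\<Phi> t + a) * exp (- a * t)) has_real_derivative (a * (\<Phi> t + a) - P t) * exp (- a * t)) (at t within {..0})"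
      by (rule derivative_eq_intros Phi_deriv[rule_format, OF t] refl)+ (simp add: algebra_simps)
  qed
  from deriv_nonneg_imp_le[OF this _ t] P_le
  have "- (\<Phi> t + a) * exp (- a * t) \<le> - (\<Phi> 0 + a) * exp (- a * 0)" by fastforce
  then have "a \<le> (\<Phi> t + a) * exp (- a * t)"
    unfolding anchored mult_minus_left by simp
  then have "a * exp (a * t) \<le> (\<Phi> t + a) * exp (- a * t) * exp (a * t)"
    by (intro mult_right_mono) auto
  then show ?thesis by (simp add: mult.assoc algebra_simps flip: exp_add)
qed

end

end

section \<open>Passage to the boundary value problem and uniqueness\<close>

lemma deriv_on_half_line_eq:
  assumes "has_deriv_half_line f f'" "t \<le> 0"
  shows "deriv_on {..0} f t = f' t"
  unfolding deriv_on_def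
  by (rule vector_derivative_within[OF half_line_not_isolated[OF assms(2)]])
    (use assms in \<open>simp flip: has_real_derivative_iff_has_vector_derivative\<close>)

lemma has_deriv_half_line_cong:
  assumes f: "has_deriv_half_line f f'" and eq: "\<And>t. t \<le> 0 \<Longrightarrow> g t = f t" "\<And>t. t \<le> 0 \<Longrightarrow> g' t = f' t"
  shows "has_deriv_half_line g g'"
proof (intro allI impI)
  fix t :: real assume t: "t \<le> 0"
  have "(g has_derivative (*) (f' t)) (at t within {..0})"
    by (rule has_derivative_transform[where f = f])
      (use f t eq in \<open>auto simp: has_field_derivative_def\<close>)
  then show "(g has_real_derivative g' t) (at t within {..0})"
    using eq(2)[OF t] by (simp add: has_field_derivative_def)
qed

lemma has_deriv_half_line_imp_differentiable_on:
  "has_deriv_half_line f f' \<Longrightarrow> f differentiable_on {..0}"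
  unfolding differentiable_on_def has_field_derivative_def by (auto intro: differentiableI)

lemma differentiable_on_imp_has_deriv_half_line:
  assumes "f differentiable_on {..0}"
  shows "has_deriv_half_line f (deriv_on {..0} f)"
  using assms unfolding differentiable_on_def deriv_on_def
  by (simp add: has_real_derivative_iff_has_vector_derivative vector_derivative_works)

context decaying_solution
begin

lemma deriv_on_Phi: "t \<le> 0 \<Longrightarrow> deriv_on {..0} \<Phi> t = P t"
  by (rule deriv_on_half_line_eq[OF Phi_deriv])

lemma deriv_on_Phi_deriv: "has_deriv_half_line (deriv_on {..0} \<Phi>) Q"
  by (rule has_deriv_half_line_cong[OF P_deriv]) (simp_all add: deriv_on_Phi)

lemma deriv_on_deriv_on_Phi: "t \<le> 0 \<Longrightarrow> deriv_on {..0} (deriv_on {..0} \<Phi>) t = Q t"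
  by (rule deriv_on_half_line_eq[OF deriv_on_Phi_deriv])

lemma ode_solution_on_half_line:
  assumes c: "c = (2 * m - 1) / m"
  shows "ode_solution_on m {..0} \<Phi>"
proof -
  have "has_deriv_half_line (\<lambda>s. Q s + \<Phi> s * P s) (\<lambda>t. c * (P t)\<^sup>2)"
  proof (intro allI impI)
    fix t :: real assume t: "t \<le> 0"
    show "((\<lambda>s. Q s + \<Phi> s * P s) has_real_derivative c * (P t)\<^sup>2) (at t within {..0})"
      by (rule derivative_eq_intros Phi_deriv[rule_format, OF t] P_deriv[rule_format, OF t]
          Q_deriv[rule_format, OF t] refl)+
         (simp add: algebra_simps power2_eq_square)
  qed
  then have "has_deriv_half_line
      (\<lambda>s. deriv_on {..0} (deriv_on {..0} \<Phi>) s + \<Phi> s * deriv_on {..0} \<Phi> s)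
      (\<lambda>t. (2 * m - 1) / m * (deriv_on {..0} \<Phi> t)\<^sup>2)"
    by (rule has_deriv_half_line_cong) (simp_all add: deriv_on_Phi deriv_on_deriv_on_Phi c)
  then show ?thesis
    unfolding ode_solution_on_def
    using has_deriv_half_line_imp_differentiable_on[OF Phi_deriv]
      has_deriv_half_line_imp_differentiable_on[OF deriv_on_Phi_deriv] by simp
qed

lemma bvp_solution_of_anchored:
  assumes c: "c = (2 * m - 1) / m" and anchored: "\<Phi> 0 = 0"
  shows "bvp_solution m a \<Phi>"
  unfolding bvp_solution_def
proof (intro conjI ballI ode_solution_on_half_line[OF c] anchored)
  fix \<epsilon> assume \<epsilon>: "\<epsilon> \<in> {0<..<a}"
  show "((\<lambda>\<tau>. exp (- \<epsilon> * \<tau>) * (\<Phi> \<tau> + a)) \<longlongrightarrow> 0) at_bot" by (rule decay(1)[OF \<epsilon>])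
  show "((\<lambda>\<tau>. exp (- \<epsilon> * \<tau>) * deriv_on {..0} \<Phi> \<tau>) \<longlongrightarrow> 0) at_bot"
    by (rule Lim_transform_eventually[OF decay(2)[OF \<epsilon>] eventually_at_bot_half_line[of 0]])
      (simp add: deriv_on_Phi)
  show "((\<lambda>\<tau>. exp (- \<epsilon> * \<tau>) * deriv_on {..0} (deriv_on {..0} \<Phi>) \<tau>) \<longlongrightarrow> 0) at_bot"
    by (rule Lim_transform_eventually[OF decay(3)[OF \<epsilon>] eventually_at_bot_half_line[of 0]])
      (simp add: deriv_on_deriv_on_Phi)
qed

end

lemma decaying_solution_of_bvp_solution:
  assumes m: "1 / 2 \<le> m" and a: "0 < a" and sol: "bvp_solution m a \<Phi>"
  shows "decaying_solution a ((2 * m - 1) / m) \<Phi> (deriv_on {..0} \<Phi>) (deriv_on {..0} (deriv_on {..0} \<Phi>))"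
proof -
  define P where "P = deriv_on {..0} \<Phi>"
  define Q where "Q = deriv_on {..0} P"
  define c where "c = (2 * m - 1) / m"
  have ode: "ode_solution_on m {..0} \<Phi>" using sol by (simp add: bvp_solution_def)
  have Phi: "has_deriv_half_line \<Phi> P"
    unfolding P_def using ode 
    by (intro differentiable_on_imp_has_deriv_half_line) (simp add: ode_solution_on_def)
  have P: "has_deriv_half_line P Q"
    unfolding Q_def using ode unfolding P_def
    by (intro differentiable_on_imp_has_deriv_half_line) (simp add: ode_solution_on_def)
  have Q: "has_deriv_half_line Q (\<lambda>t. (c - 1) * (P t)\<^sup>2 - \<Phi> t * Q t)"
  proof (intro allI impI)
    fix t :: real assume t: "t \<le> 0"
    have S: "((\<lambda>s. Q s + \<Phi> s * P s) has_real_derivative c * (P t)\<^sup>2) (at t within {..0})"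
      using ode t unfolding ode_solution_on_def P_def[symmetric] Q_def[symmetric] c_def by simp
    have "((\<lambda>s. (Q s + \<Phi> s * P s) - \<Phi> s * P s) has_real_derivative
        (c - 1) * (P t)\<^sup>2 - \<Phi> t * Q t) (at t within {..0})"
      by (rule DERIV_cong[OF DERIV_diff[OF S DERIV_mult[OF Phi[rule_format, OF t] P[rule_format, OF t]]]])
        (simp add: algebra_simps power2_eq_square)
    then show "(Q has_real_derivative (c - 1) * (P t)\<^sup>2 - \<Phi> t * Q t) (at t within {..0})" by simp
  qed
  have c: "0 \<le> c" "c \<le> 2" using m by (auto simp: c_def field_simps)
  have "decaying_solution a c \<Phi> P Q"
  proof
    show "0 < a" "0 \<le> c" "c \<le> 2" by (fact a c)+
    show "has_deriv_half_line \<Phi> P" "has_deriv_half_line P Q"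
      "has_deriv_half_line Q (\<lambda>t. (c - 1) * (P t)\<^sup>2 - \<Phi> t * Q t)" by (fact Phi P Q)+
    fix \<epsilon> assume "\<epsilon> \<in> {0<..<a}"
    then show "((\<lambda>t. exp (- \<epsilon> * t) * (\<Phi> t + a)) \<longlongrightarrow> 0) at_bot"
      "((\<lambda>t. exp (- \<epsilon> * t) * P t) \<longlongrightarrow> 0) at_bot"
      "((\<lambda>t. exp (- \<epsilon> * t) * Q t) \<longlongrightarrow> 0) at_bot"
      using sol unfolding bvp_solution_def P_def[symmetric] Q_def[symmetric] by blast+
  qed
  then show ?thesis by (simp add: c_def Q_def P_def)
qed

text \<open>
  Shifting the solution of larger amplitude by some \<open>s \<le> 0\<close> matches the amplitudes, so
  \<open>\<Phi>\<^sub>1 t = \<Phi>\<^sub>2 (t + s)\<close>. At \<open>t = 0\<close> strict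
  monotonicity leaves only \<open>s = 0\<close>.
\<close>

lemma anchored_solutions_equal:
  assumes S1: "decaying_solution a c \<Phi>\<^sub>1 P\<^sub>1 Q\<^sub>1" and S2: "decaying_solution a c \<Phi>\<^sub>2 P\<^sub>2 Q\<^sub>2"
    and anchored: "\<Phi>\<^sub>1 0 = 0" "\<Phi>\<^sub>2 0 = 0"
    and le: "decaying_solution.amplitude a P\<^sub>1 \<le> decaying_solution.amplitude a P\<^sub>2"
    and t: "t \<le> 0"
  shows "\<Phi>\<^sub>1 t = \<Phi>\<^sub>2 t"
proof -
  interpret A: decaying_solution a c \<Phi>\<^sub>1 P\<^sub>1 Q\<^sub>1 by (rule S1)
  interpret B: decaying_solution a c \<Phi>\<^sub>2 P\<^sub>2 Q\<^sub>2 by (rule S2)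
  note pos = A.amplitude_pos[OF anchored(1)] B.amplitude_pos[OF anchored(2)]
  \<comment> \<open>A shift by \<open>s\<close> multiplies the amplitude by \<open>exp (a s)\<close>.\<close>
  define s where "s = ln (A.amplitude / B.amplitude) / a"
  have s: "s \<le> 0" using le pos A.a_pos by (simp add: s_def divide_nonpos_pos ln_le_zero_iff)
  have "exp (a * s) * B.amplitude = A.amplitude" using pos A.a_pos by (simp add: s_def)
  then have amp: "A.amplitude = decaying_solution.amplitude a (\<lambda>t. P\<^sub>2 (t + s))"
    using B.shift(2)[OF s] by simp
  have eq: "\<Phi>\<^sub>1 t = \<Phi>\<^sub>2 (t + s)" if "t \<le> 0" for t
    by (rule same_amplitude_imp_equal[OF S1 B.shift(1)[OF s] amp that])
  from eq[of 0] have "\<Phi>\<^sub>2 s = \<Phi>\<^sub>2 0" using anchored by simp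
  then have "s = 0"
    using deriv_pos_imp_less[OF B.Phi_deriv B.P_pos[OF pos(2)], of s 0] s by (cases "s = 0") auto
  with eq[OF t] show ?thesis by simp
qed

lemma bvp_solution_unique:
  assumes m: "1 / 2 \<le> m" and a: "0 < a" and sol: "bvp_solution m a \<Phi>" "bvp_solution m a \<Psi>" and t: "t \<le> 0"
  shows "\<Psi> t = \<Phi> t"
proof -
  note S = decaying_solution_of_bvp_solution[OF m a sol(1)] decaying_solution_of_bvp_solution[OF m a sol(2)]
  have z: "\<Phi> 0 = 0" "\<Psi> 0 = 0" using sol by (auto simp: bvp_solution_def)
  show ?thesis
    using anchored_solutions_equal[OF S z _ t] anchored_solutions_equal[OF S(2,1) z(2,1) _ t]
    by (metis linear)
qed

section \<open>The coefficients and sums of the Lyapunov series\<close>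

lemma sum_symmetrize:
  fixes f :: "nat \<Rightarrow> real"
  shows "(\<Sum>k = 1..l - 1. f k) = (\<Sum>k = 1..l - 1. (f k + f (l - k)) / 2)"
proof -
  have "(\<Sum>k = 1..l - 1. f k) = (\<Sum>k = 1..l - 1. f (l - k))"
    by (rule sum.reindex_bij_witness[of _ "\<lambda>k. l - k" "\<lambda>k. l - k"]) auto
  then have "2 * (\<Sum>k = 1..l - 1. f k) = (\<Sum>k = 1..l - 1. f k + f (l - k))"
    by (simp add: sum.distrib)
  then show ?thesis by (simp flip: sum_divide_distrib)
qed

lemma lyap_coeff_0 [simp]: "lyap_coeff m a 0 = 0"
  and lyap_coeff_1 [simp]: "lyap_coeff m a (Suc 0) = 1"
  by (simp_all add: lyap_coeff.simps)

text \<open>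
  Averaging the summands for \<open>k\<close> and \<open>l - k\<close> turns the coefficient into
  \<open>c k (l - k) - l\<^sup>2 / 2\<close>. For \<open>m \<ge> 1 / 2\<close> it is at most zero
  because \<open>c \<le> 2\<close> and \<open>4 k (l - k) \<le> l\<^sup>2\<close>, so its absolute
  value can be summed in closed form.
\<close>

lemma lyap_coeff_symmetric:
  assumes m: "m \<noteq> 0" and l: "2 \<le> l"
  shows "lyap_coeff m a l = 1 / (a * (real l)\<^sup>2 * (real l - 1)) *
    (\<Sum>k = 1..l - 1. ((2 * m - 1) / m * (real k * (real l - real k)) - (real l)\<^sup>2 / 2)
      * (lyap_coeff m a k * lyap_coeff m a (l - k)))"
proof -
  define c where "c = (2 * m - 1) / m"
  have c: "(m - 1) * x / m = (c - 1) * x" for x using m by (simp add: c_def field_simps)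
  let ?h = "lyap_coeff m a"
  define f where "f = (\<lambda>k. real k * ((c - 1) * (real l - real k) - real k) * ?h k * ?h (l - k))"
  have "?h l = 1 / (a * (real l)\<^sup>2 * (real l - 1)) * (\<Sum>k = 1..l - 1. f k)"
    using l by (subst lyap_coeff.simps) (simp add: f_def c)
  also have "(\<Sum>k = 1..l - 1. f k) = (\<Sum>k = 1..l - 1. (f k + f (l - k)) / 2)" by (rule sum_symmetrize)
  also have "\<dots> = (\<Sum>k = 1..l - 1. (c * (real k * (real l - real k)) - (real l)\<^sup>2 / 2) * (?h k * ?h (l - k)))"
  proof (rule sum.cong[OF refl])
    fix k assume "k \<in> {1..l - 1}"
    then have "real (l - k) = real l - real k" "l - (l - k) = k" by (auto simp: of_nat_diff)
    then show "(f k + f (l - k)) / 2 = (c * (real k * (real l - real k)) - (real l)\<^sup>2 / 2) * (?h k * ?h (l - k))"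
      unfolding f_def by (simp add: field_simps power2_eq_square)
  qed
  finally show ?thesis by (simp add: c_def)
qed

lemma sum_product_complement:
  "(\<Sum>k = 1..n. real k * (x - real k)) = x * (real n * (real n + 1) / 2) - real n * (real n + 1) * (2 * real n + 1) / 6"
  by (induction n) (simp_all add: field_simps)

text \<open>
  In the symmetric recursion, \<open>k (l - k)\<close> has mean \<open>l (l + 1) / 6\<close> over
  \<open>1 \<le> k < l\<close>, which is at least \<open>l\<^sup>2 / 6\<close>. This yields the factor
  \<open>1 - c / 3\<close>, which for \<open>c > 0\<close> pushes the radius of convergence beyond
  \<open>2 a\<close>.
\<close>

lemma lyap_coeff_bound:
  assumes m: "1 / 2 \<le> m" and a: "0 < a" and l: "1 \<le> l"
  shows "\<bar>lyap_coeff m a l\<bar> \<le> ((1 - (2 * m - 1) / m / 3) / (2 * a)) ^ (l - 1)"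
  using l
proof (induction l rule: less_induct)
  case (less l)
  define c where "c = (2 * m - 1) / m"
  have c: "0 \<le> c" "c \<le> 2" using m by (auto simp: c_def field_simps)
  define A where "A = (1 - c / 3) / (2 * a)"
  have A: "0 \<le> A" using c a by (simp add: A_def)
  let ?h = "lyap_coeff m a"
  have IH: "\<bar>?h k\<bar> \<le> A ^ (k - 1)" if "1 \<le> k" "k < l" for k
    using less.IH[OF that(2,1)] by (simp add: A_def c_def)
  show ?case
  proof (cases "l = 1")
    case False
    with less.prems have l: "2 \<le> l" by simp
    then have lr: "2 \<le> real l" by simp
    have q: "0 \<le> (real l)\<^sup>2 / 2 - c * (real k * (real l - real k))" if "k \<in> {1..l - 1}" for k
    proof -
      have "0 \<le> real k * (real l - real k)" using that by (intro mult_nonneg_nonneg) auto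
      then have "c * (real k * (real l - real k)) \<le> 2 * (real k * (real l - real k))"
        using c by (intro mult_right_mono) auto
      also have "\<dots> \<le> (real l)\<^sup>2 / 2"
        using zero_le_power2[of "real l - 2 * real k"] by (simp add: power2_eq_square algebra_simps)
      finally show ?thesis by simp
    qed
    have D: "0 < a * (real l)\<^sup>2 * (real l - 1)" using a lr by simp
    have "\<bar>\<Sum>k = 1..l - 1. (c * (real k * (real l - real k)) - (real l)\<^sup>2 / 2) * (?h k * ?h (l - k))\<bar>
        \<le> (\<Sum>k = 1..l - 1. ((real l)\<^sup>2 / 2 - c * (real k * (real l - real k))) * A ^ (l - 2))"
    proof (rule order_trans[OF sum_abs sum_mono])
      fix k assume k: "k \<in> {1..l - 1}"
      have "\<bar>?h k * ?h (l - k)\<bar> \<le> A ^ (k - 1) * A ^ (l - k - 1)"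
        unfolding abs_mult using k A by (intro mult_mono IH) auto
      also have "\<dots> = A ^ (l - 2)"
      proof -
        have "k - 1 + (l - k - 1) = l - 2" using k by auto
        then show ?thesis by (simp only: flip: power_add)
      qed
      finally have "\<bar>?h k * ?h (l - k)\<bar> \<le> A ^ (l - 2)" .
      moreover have "\<bar>c * (real k * (real l - real k)) - (real l)\<^sup>2 / 2\<bar> = (real l)\<^sup>2 / 2 - c * (real k * (real l - real k))"
        using q[OF k] by simp
      ultimately show "\<bar>(c * (real k * (real l - real k)) - (real l)\<^sup>2 / 2) * (?h k * ?h (l - k))\<bar>
          \<le> ((real l)\<^sup>2 / 2 - c * (real k * (real l - real k))) * A ^ (l - 2)"
        unfolding abs_mult[of "_ - _"] using q[OF k] by (simp only:) (rule mult_left_mono)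
    qed
    also have "\<dots> = ((real l - 1) * (real l)\<^sup>2 / 2 - c * ((real l - 1) * real l * (real l + 1) / 6)) * A ^ (l - 2)"
    proof -
      have "(\<Sum>k = 1..l - 1. real k * (real l - real k)) = (real l - 1) * real l * (real l + 1) / 6"
        unfolding sum_product_complement using l by (simp add: of_nat_diff field_simps)
      then show ?thesis
        using l by (simp add: sum_subtractf of_nat_diff flip: sum_distrib_right sum_distrib_left)
    qed
    finally have "1 / (a * (real l)\<^sup>2 * (real l - 1)) *
        \<bar>\<Sum>k = 1..l - 1. (c * (real k * (real l - real k)) - (real l)\<^sup>2 / 2) * (?h k * ?h (l - k))\<bar>
      \<le> 1 / (a * (real l)\<^sup>2 * (real l - 1)) *
        (((real l - 1) * (real l)\<^sup>2 / 2 - c * ((real l - 1) * real l * (real l + 1) / 6)) * A ^ (l - 2))"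
      using D by (intro mult_left_mono) auto
    moreover have "\<bar>?h l\<bar> = 1 / (a * (real l)\<^sup>2 * (real l - 1)) *
        \<bar>\<Sum>k = 1..l - 1. (c * (real k * (real l - real k)) - (real l)\<^sup>2 / 2) * (?h k * ?h (l - k))\<bar>"
    proof -
      have eq: "?h l = 1 / (a * (real l)\<^sup>2 * (real l - 1)) *
          (\<Sum>k = 1..l - 1. (c * (real k * (real l - real k)) - (real l)\<^sup>2 / 2) * (?h k * ?h (l - k)))"
        unfolding c_def by (rule lyap_coeff_symmetric) (use m l in auto)
      have D': "\<bar>1 / (a * (real l)\<^sup>2 * (real l - 1))\<bar> = 1 / (a * (real l)\<^sup>2 * (real l - 1))"
        by (rule abs_of_nonneg[OF less_imp_le[OF divide_pos_pos[OF zero_less_one D]]])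
      show ?thesis by (subst eq, subst abs_mult, subst D') (rule refl)
    qed
    ultimately have "\<bar>?h l\<bar> \<le> 1 / (a * (real l)\<^sup>2 * (real l - 1)) *
        (((real l - 1) * (real l)\<^sup>2 / 2 - c * ((real l - 1) * real l * (real l + 1) / 6)) * A ^ (l - 2))"
      by (simp only:)
    also have "\<dots> = (1 / 2 - c * (real l + 1) / (6 * real l)) / a * A ^ (l - 2)"
      using a lr by (simp add: field_simps power2_eq_square)
    also have "\<dots> \<le> (1 / 2 - c / 6) / a * A ^ (l - 2)"
      using a lr c A by (intro mult_right_mono divide_right_mono) (auto simp: field_simps)
    also have "(1 / 2 - c / 6) / a = A" using a by (simp add: A_def field_simps)
    also have "A * A ^ (l - 2) = A ^ (l - 1)"
    proof -
      have "Suc (l - 2) = l - 1" using l by simp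
      then show ?thesis by (simp only: flip: power_Suc)
    qed
    finally show ?thesis by (simp add: A_def c_def)
  qed simp
qed

lemma lyap_coeff_half:
  assumes a: "0 < a" and l: "1 \<le> l"
  shows "lyap_coeff (1 / 2) a l = (- 1 / (2 * a)) ^ (l - 1)"
  using l
proof (induction l rule: less_induct)
  case (less l)
  show ?case
  proof (cases "l = 1")
    case False
    with less.prems have l: "2 \<le> l" by simp
    then have lr: "2 \<le> real l" by simp
    define q where "q = - 1 / (2 * a)"
    have "(\<Sum>k = 1..l - 1. - ((real l)\<^sup>2 / 2) * (lyap_coeff (1 / 2) a k * lyap_coeff (1 / 2) a (l - k)))
      = (\<Sum>k = 1..l - 1. - ((real l)\<^sup>2 / 2) * q ^ (l - 2))"
    proof (rule sum.cong[OF refl])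
      fix k assume k: "k \<in> {1..l - 1}"
      then have "lyap_coeff (1 / 2) a k * lyap_coeff (1 / 2) a (l - k) = q ^ (k - 1) * q ^ (l - k - 1)"
        using less.IH[of k] less.IH[of "l - k"] unfolding q_def by auto
      also have "\<dots> = q ^ (l - 2)"
      proof -
        have "k - 1 + (l - k - 1) = l - 2" using k by auto
        then show ?thesis by (simp only: flip: power_add)
      qed
      finally show "- ((real l)\<^sup>2 / 2) * (lyap_coeff (1 / 2) a k * lyap_coeff (1 / 2) a (l - k))
        = - ((real l)\<^sup>2 / 2) * q ^ (l - 2)" by simp
    qed
    also have "\<dots> = - ((real l - 1) * (real l)\<^sup>2 / 2) * q ^ (l - 2)"
      using l by (simp add: of_nat_diff)
    finally have "lyap_coeff (1 / 2) a l = 1 / (a * (real l)\<^sup>2 * (real l - 1)) * (- ((real l - 1) * (real l)\<^sup>2 / 2) * q ^ (l - 2))"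
      using l by (subst lyap_coeff_symmetric) simp_all
    also have "\<dots> = q * q ^ (l - 2)"
      using a lr by (simp add: q_def field_simps)
    also have "\<dots> = q ^ (l - 1)"
    proof -
      have "Suc (l - 2) = l - 1" using l by simp
      then show ?thesis by (simp only: flip: power_Suc)
    qed
    finally show ?thesis by (simp add: q_def)
  qed simp
qed

text \<open>
  Derivatives with respect to \<open>\<tau>\<close> of a series in
  \<open>x = d e\<^sup>a\<^sup>\<tau>\<close> are given by the Euler operator \<open>x d/dx\<close>, which
  multiplies the coefficients by \<open>n\<close>.
\<close>

lemma euler_operator_summable:
  fixes c :: "nat \<Rightarrow> real"
  assumes "\<And>x. \<bar>x\<bar> < r \<Longrightarrow> summable (\<lambda>n. c n * x ^ n)" and x: "\<bar>x\<bar> < r"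
  shows "summable (\<lambda>n. real n * c n * x ^ n)" 
    and "x * (\<Sum>n. diffs c n * x ^ n) = (\<Sum>n. real n * c n * x ^ n)"
proof -
  have "summable (\<lambda>n. diffs c n * x ^ n)"
    by (rule termdiff_converges[of _ r]) (use assms in auto)
  from sums_mult[OF diffs_equiv[OF this], of x]
  have "(\<lambda>n. x * (real n * c n * x ^ (n - Suc 0))) sums (x * (\<Sum>n. diffs c n * x ^ n))" .
  moreover have "x * (real n * c n * x ^ (n - Suc 0)) = real n * c n * x ^ n" for n
    by (cases n) auto
  ultimately have "(\<lambda>n. real n * c n * x ^ n) sums (x * (\<Sum>n. diffs c n * x ^ n))" by simp
  then show "summable (\<lambda>n. real n * c n * x ^ n)"
    "x * (\<Sum>n. diffs c n * x ^ n) = (\<Sum>n. real n * c n * x ^ n)"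
    by (simp_all add: sums_iff)
qed

lemma abs_mult_exp_less:
  fixes d :: real
  assumes "\<bar>d\<bar> < r" "0 < a" "t \<le> 0"
  shows "\<bar>d * exp (a * t)\<bar> < r"
proof -
  have "exp (a * t) \<le> 1" using assms by (simp add: mult_nonneg_nonpos)
  then have "\<bar>d\<bar> * exp (a * t) \<le> \<bar>d\<bar>" by (rule mult_right_le_one_le[rotated 2]) auto
  then show ?thesis using assms by (simp add: abs_mult)
qed

lemma exp_series_deriv:
  fixes c :: "nat \<Rightarrow> real"
  assumes sm: "\<And>x. \<bar>x\<bar> < r \<Longrightarrow> summable (\<lambda>n. c n * x ^ n)" and d: "\<bar>d\<bar> < r" and a: "0 < a"
  shows "has_deriv_half_line (\<lambda>t. \<Sum>n. c n * (d * exp (a * t)) ^ n)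
    (\<lambda>t. a * (\<Sum>n. real n * c n * (d * exp (a * t)) ^ n))"
proof (intro allI impI)
  fix t :: real assume "t \<le> 0"
  then have x: "\<bar>d * exp (a * t)\<bar> < r" by (rule abs_mult_exp_less[OF d a])
  have "DERIV (\<lambda>x. \<Sum>n. c n * x ^ n) (d * exp (a * t)) :> (\<Sum>n. diffs c n * (d * exp (a * t)) ^ n)"
    by (rule termdiffs_strong'[of r]) (use sm x in auto)
  moreover have "((\<lambda>t. d * exp (a * t)) has_real_derivative a * (d * exp (a * t))) (at t within {..0})"
    by (auto intro!: derivative_eq_intros)
  ultimately have "((\<lambda>t. \<Sum>n. c n * (d * exp (a * t)) ^ n) has_real_derivative
    (\<Sum>n. diffs c n * (d * exp (a * t)) ^ n) * (a * (d * exp (a * t)))) (at t within {..0})"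
    by (rule DERIV_chain2)
  moreover have "(\<Sum>n. diffs c n * (d * exp (a * t)) ^ n) * (a * (d * exp (a * t)))
    = a * (\<Sum>n. real n * c n * (d * exp (a * t)) ^ n)"
    using euler_operator_summable(2)[OF sm x] by (simp add: mult_ac)
  ultimately show "((\<lambda>t. \<Sum>n. c n * (d * exp (a * t)) ^ n) has_real_derivative
    a * (\<Sum>n. real n * c n * (d * exp (a * t)) ^ n)) (at t within {..0})" by (simp only:)
qed

text \<open>
  Without constant term the series is \<open>x\<close> times a function that is continuous at
  \<open>x = 0\<close>.
\<close>

lemma exp_series_lim:
  fixes c :: "nat \<Rightarrow> real"
  assumes sm: "\<And>x. \<bar>x\<bar> < r \<Longrightarrow> summable (\<lambda>n. c n * x ^ n)" and d: "\<bar>d\<bar> < r" and a: "0 < a"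
    and c0: "c 0 = 0"
  shows "((\<lambda>t. (\<Sum>n. c n * (d * exp (a * t)) ^ n) * exp (- a * t)) \<longlongrightarrow> d * c 1) at_bot"
proof -
  define g where "g = (\<lambda>x. \<Sum>n. c (Suc n) * x ^ n)"
  have split: "(\<Sum>n. c n * x ^ n) = g x * x" if "\<bar>x\<bar> < r" for x
    using powser_split_head(1)[OF sm[OF that]] c0 by (simp add: g_def)
  have r: "0 < r / 2" "\<bar>r / 2\<bar> < r" using d by auto
  have "summable (\<lambda>n. c (Suc n) * (r / 2) ^ n)"
    by (rule powser_split_head(3)[OF sm[OF r(2)]])
  then have "isCont g 0" unfolding g_def by (rule isCont_powser) (use r in auto)
  moreover have "((\<lambda>t. d * exp (a * t)) \<longlongrightarrow> d * 0) at_bot"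
    by (intro tendsto_intros exp_scaled_at_bot a)
  ultimately have "((\<lambda>t. g (d * exp (a * t))) \<longlongrightarrow> g 0) at_bot"
    using isCont_tendsto_compose[of 0 g] by simp
  then have "((\<lambda>t. d * g (d * exp (a * t))) \<longlongrightarrow> d * g 0) at_bot" by (intro tendsto_intros)
  moreover have "g 0 = c 1" by (simp add: g_def)
  ultimately have lim: "((\<lambda>t. d * g (d * exp (a * t))) \<longlongrightarrow> d * c 1) at_bot" by simp
  show ?thesis
  proof (rule Lim_transform_eventually[OF lim eventually_at_bot_half_line[of 0]])
    fix t :: real assume "t \<le> 0"
    then have "\<bar>d * exp (a * t)\<bar> < r" by (rule abs_mult_exp_less[OF d a])
    from split[OF this]
    show "d * g (d * exp (a * t)) = (\<Sum>n. c n * (d * exp (a * t)) ^ n) * exp (- a * t)"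
      by (simp add: exp_minus)
  qed
qed

lemma decay_of_scaled_lim:
  assumes lim: "((\<lambda>t. f t * exp (- a * t)) \<longlongrightarrow> l) at_bot" and \<epsilon>: "\<epsilon> \<in> {0<..<a}"
  shows "((\<lambda>t. exp (- \<epsilon> * t) * f t) \<longlongrightarrow> (0::real)) at_bot"
proof -
  have "((\<lambda>t. exp ((a - \<epsilon>) * t) * (f t * exp (- a * t))) \<longlongrightarrow> 0 * l) at_bot"
    by (intro tendsto_mult exp_scaled_at_bot lim) (use \<epsilon> in auto)
  moreover have "exp ((a - \<epsilon>) * t) * (f t * exp (- a * t)) = exp (- \<epsilon> * t) * f t" for t
  proof -
    have "exp ((a - \<epsilon>) * t) * exp (- a * t) = exp (- \<epsilon> * t)"
      by (simp add: algebra_simps flip: exp_add)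
    then show ?thesis by (simp add: mult_ac)
  qed
  ultimately show ?thesis by (simp only: mult_zero_left)
qed

lemma cauchy_product_powser:
  fixes u v :: "nat \<Rightarrow> real"
  assumes u: "\<And>x. \<bar>x\<bar> < r \<Longrightarrow> summable (\<lambda>n. u n * x ^ n)"
    and v: "\<And>x. \<bar>x\<bar> < r \<Longrightarrow> summable (\<lambda>n. v n * x ^ n)" and x: "\<bar>x\<bar> < r"
  shows "(\<lambda>n. (\<Sum>i\<le>n. u i * v (n - i)) * x ^ n) sums ((\<Sum>n. u n * x ^ n) * (\<Sum>n. v n * x ^ n))"
proof -
  \<comment> \<open>A point strictly between \<open>\<bar>x\<bar>\<close> and \<open>r\<close>, at which convergence gives absolute convergence at \<open>x\<close>.\<close>
  define y where "y = (\<bar>x\<bar> + r) / 2"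
  have y: "\<bar>y\<bar> < r" "norm x < norm y" using x by (auto simp: y_def)
  from Cauchy_product_sums[OF powser_insidea[OF u[OF y(1)] y(2)] powser_insidea[OF v[OF y(1)] y(2)]]
  have "(\<lambda>n. \<Sum>i\<le>n. (u i * x ^ i) * (v (n - i) * x ^ (n - i))) sums
    ((\<Sum>n. u n * x ^ n) * (\<Sum>n. v n * x ^ n))" .
  moreover have "(\<Sum>i\<le>n. (u i * x ^ i) * (v (n - i) * x ^ (n - i))) = (\<Sum>i\<le>n. u i * v (n - i)) * x ^ n" for n
    unfolding sum_distrib_right
  proof (rule sum.cong[OF refl])
    fix i assume "i \<in> {..n}"
    then have "x ^ i * x ^ (n - i) = x ^ n" by (simp flip: power_add)
    then show "(u i * x ^ i) * (v (n - i) * x ^ (n - i)) = u i * v (n - i) * x ^ n"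
      by (simp add: mult_ac)
  qed
  ultimately show ?thesis by simp
qed

section \<open>Existence of the anchored solution\<close>

text \<open>
  The recursion says exactly that the coefficients of \<open>x\<^sup>n\<close> in the equation agree; the
  boundary summands \<open>i = 0\<close> and \<open>i = n\<close> drop out because the coefficient with
  index \<open>0\<close> is zero.
\<close>

lemma lyap_coeff_convolution:
  assumes m: "m \<noteq> 0" and a: "a \<noteq> 0"
  defines "h \<equiv> lyap_coeff m a"
  shows "a * (real n * (real n * (real n * h n))) - a * (real n * (real n * h n)) =
    ((2 * m - 1) / m - 1) * (\<Sum>i\<le>n. (real i * h i) * (real (n - i) * h (n - i)))
      - (\<Sum>i\<le>n. h i * (real (n - i) * (real (n - i) * h (n - i))))"
proof -
  define c where "c = (2 * m - 1) / m"
  have c: "(m - 1) * x / m = (c - 1) * x" for x using m by (simp add: c_def field_simps)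
  define f where "f = (\<lambda>i. (c - 1) * ((real i * h i) * (real (n - i) * h (n - i)))
    - (real i * (real i * h i)) * h (n - i))"
  have h0: "h 0 = 0" by (simp add: h_def)
  have "(\<Sum>i\<le>n. h i * (real (n - i) * (real (n - i) * h (n - i))))
      = (\<Sum>i\<le>n. (real i * (real i * h i)) * h (n - i))"
    by (rule sum.reindex_bij_witness[of _ "\<lambda>i. n - i" "\<lambda>i. n - i"]) auto
  then have "(c - 1) * (\<Sum>i\<le>n. (real i * h i) * (real (n - i) * h (n - i)))
      - (\<Sum>i\<le>n. h i * (real (n - i) * (real (n - i) * h (n - i)))) = (\<Sum>i\<le>n. f i)"
    by (simp add: f_def sum_subtractf sum_distrib_left)
  also have "\<dots> = (\<Sum>i = 1..n - 1. f i)"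
  proof (rule sum.mono_neutral_right)
    show "\<forall>i\<in>{..n} - {1..n - 1}. f i = 0"
    proof
      fix i assume "i \<in> {..n} - {1..n - 1}"
      then have "i = 0 \<or> i = n" by auto
      then show "f i = 0" by (auto simp: f_def h0)
    qed
  qed auto
  also have "\<dots> = a * (real n * (real n * (real n * h n))) - a * (real n * (real n * h n))"
  proof (cases "n \<le> 1")
    case True
    then consider "n = 0" | "n = 1" by linarith
    then show ?thesis by cases simp_all
  next
    case False
    then have n: "2 \<le> n" by simp
    have "(\<Sum>i = 1..n - 1. f i) = (\<Sum>k = 1..n - 1. real k * ((m - 1) * (real n - real k) / m - real k) * h k * h (n - k))"
    proof (rule sum.cong[OF refl])
      fix k assume "k \<in> {1..n - 1}"
      then have "real (n - k) = real n - real k" by (auto simp: of_nat_diff)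
      then show "f k = real k * ((m - 1) * (real n - real k) / m - real k) * h k * h (n - k)"
        unfolding f_def c by (simp add: algebra_simps)
    qed
    moreover have "h n = 1 / (a * (real n)\<^sup>2 * (real n - 1)) *
        (\<Sum>k = 1..n - 1. real k * ((m - 1) * (real n - real k) / m - real k) * h k * h (n - k))"
      using n unfolding h_def by (subst lyap_coeff.simps) simp
    moreover have "a * (real n)\<^sup>2 * (real n - 1) \<noteq> 0" using a n by simp
    ultimately have "(\<Sum>i = 1..n - 1. f i) = a * (real n)\<^sup>2 * (real n - 1) * h n"
      by simp
    then show ?thesis by (simp add: algebra_simps power2_eq_square)
  qed
  finally show ?thesis by (simp add: c_def)
qed

context
  fixes m a r :: real
  assumes m: "1 / 2 \<le> m" and a: "0 < a"
    and summable_h: "\<And>x. \<bar>x\<bar> < r \<Longrightarrow> summable (\<lambda>n. lyap_coeff m a n * x ^ n)"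
begin

lemma summable_h1: "\<bar>x\<bar> < r \<Longrightarrow> summable (\<lambda>n. real n * lyap_coeff m a n * x ^ n)"
  by (rule euler_operator_summable(1)[OF summable_h])

lemma summable_h2: "\<bar>x\<bar> < r \<Longrightarrow> summable (\<lambda>n. real n * (real n * lyap_coeff m a n) * x ^ n)"
  by (rule euler_operator_summable(1)[OF summable_h1])

lemma summable_h3: "\<bar>x\<bar> < r \<Longrightarrow> summable (\<lambda>n. real n * (real n * (real n * lyap_coeff m a n)) * x ^ n)"
  by (rule euler_operator_summable(1)[OF summable_h2])

lemma lyapunov_series_ode:
  assumes x: "\<bar>x\<bar> < r"
  shows "a * (\<Sum>n. real n * (real n * (real n * lyap_coeff m a n)) * x ^ n)
      - a * (\<Sum>n. real n * (real n * lyap_coeff m a n) * x ^ n)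
    = ((2 * m - 1) / m - 1) * (\<Sum>n. real n * lyap_coeff m a n * x ^ n)\<^sup>2
      - (\<Sum>n. lyap_coeff m a n * x ^ n) * (\<Sum>n. real n * (real n * lyap_coeff m a n) * x ^ n)"
proof (rule sums_unique2)
  show "(\<lambda>n. a * (real n * (real n * (real n * lyap_coeff m a n)) * x ^ n)
      - a * (real n * (real n * lyap_coeff m a n) * x ^ n)) sums
    (a * (\<Sum>n. real n * (real n * (real n * lyap_coeff m a n)) * x ^ n)
      - a * (\<Sum>n. real n * (real n * lyap_coeff m a n) * x ^ n))"
    by (intro sums_diff sums_mult summable_sums summable_h2 summable_h3 x)
  have "(\<lambda>n. ((2 * m - 1) / m - 1) * ((\<Sum>i\<le>n. (real i * lyap_coeff m a i) * (real (n - i) * lyap_coeff m a (n - i))) * x ^ n)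
      - (\<Sum>i\<le>n. lyap_coeff m a i * (real (n - i) * (real (n - i) * lyap_coeff m a (n - i)))) * x ^ n) sums
    (((2 * m - 1) / m - 1) * ((\<Sum>n. real n * lyap_coeff m a n * x ^ n) * (\<Sum>n. real n * lyap_coeff m a n * x ^ n))
      - (\<Sum>n. lyap_coeff m a n * x ^ n) * (\<Sum>n. real n * (real n * lyap_coeff m a n) * x ^ n))"
    by (intro sums_diff sums_mult cauchy_product_powser[of r] summable_h summable_h1 summable_h2 x)
  moreover have "((2 * m - 1) / m - 1) * ((\<Sum>i\<le>n. (real i * lyap_coeff m a i) * (real (n - i) * lyap_coeff m a (n - i))) * x ^ n)
      - (\<Sum>i\<le>n. lyap_coeff m a i * (real (n - i) * (real (n - i) * lyap_coeff m a (n - i)))) * x ^ n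
    = a * (real n * (real n * (real n * lyap_coeff m a n)) * x ^ n)
      - a * (real n * (real n * lyap_coeff m a n) * x ^ n)" for n
  proof -
    have mult: "u * (v * x ^ n) - w * x ^ n = (u * v - w) * x ^ n" for u v w :: real
      by (simp add: algebra_simps)
    show ?thesis
      unfolding mult using m a by (subst lyap_coeff_convolution[symmetric]) (auto simp: algebra_simps)
  qed
  ultimately show "(\<lambda>n. a * (real n * (real n * (real n * lyap_coeff m a n)) * x ^ n)
      - a * (real n * (real n * lyap_coeff m a n) * x ^ n)) sums
    (((2 * m - 1) / m - 1) * (\<Sum>n. real n * lyap_coeff m a n * x ^ n)\<^sup>2
      - (\<Sum>n. lyap_coeff m a n * x ^ n) * (\<Sum>n. real n * (real n * lyap_coeff m a n) * x ^ n))"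
    by (simp add: power2_eq_square)
qed

context
  fixes d :: real
  assumes d: "\<bar>d\<bar> < r"
begin

abbreviation (input) "lyap_sum \<equiv> \<lambda>t. \<Sum>n. lyap_coeff m a n * (d * exp (a * t)) ^ n"
abbreviation (input) "lyap_sum1 \<equiv> \<lambda>t. \<Sum>n. real n * lyap_coeff m a n * (d * exp (a * t)) ^ n"
abbreviation (input) "lyap_sum2 \<equiv> \<lambda>t. \<Sum>n. real n * (real n * lyap_coeff m a n) * (d * exp (a * t)) ^ n"

lemma series_decaying_solution:
  "decaying_solution a ((2 * m - 1) / m) (\<lambda>t. - a + lyap_sum t) (\<lambda>t. a * lyap_sum1 t) (\<lambda>t. a * (a * lyap_sum2 t))"
proof
  show "0 < a" by (rule a)
  show "0 \<le> (2 * m - 1) / m" "(2 * m - 1) / m \<le> 2" using m by (auto simp: field_simps)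
  show "has_deriv_half_line (\<lambda>t. - a + lyap_sum t) (\<lambda>t. a * lyap_sum1 t)"
  proof (intro allI impI)
    fix t :: real assume t: "t \<le> 0"
    show "((\<lambda>t. - a + lyap_sum t) has_real_derivative a * lyap_sum1 t) (at t within {..0})"
      by (rule DERIV_cong[OF DERIV_add[OF DERIV_const exp_series_deriv[OF summable_h d a, rule_format, OF _ t]]]) simp_all
  qed
  show "has_deriv_half_line (\<lambda>t. a * lyap_sum1 t) (\<lambda>t. a * (a * lyap_sum2 t))"
    using DERIV_cmult[OF exp_series_deriv[OF summable_h1 d a, rule_format]] by auto
  show "has_deriv_half_line (\<lambda>t. a * (a * lyap_sum2 t)) (\<lambda>t. ((2 * m - 1) / m - 1) * (a * lyap_sum1 t)\<^sup>2 - (- a + lyap_sum t) * (a * (a * lyap_sum2 t)))"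
  proof (intro allI impI)
    fix t :: real assume t: "t \<le> 0"
    let ?S3 = "\<Sum>n. real n * (real n * (real n * lyap_coeff m a n)) * (d * exp (a * t)) ^ n"
    have "((\<lambda>t. a * (a * lyap_sum2 t)) has_real_derivative a * (a * (a * ?S3))) (at t within {..0})"
      by (intro DERIV_cmult exp_series_deriv[OF summable_h2 d a, rule_format] t)
    moreover have "a * (a * (a * ?S3)) = ((2 * m - 1) / m - 1) * (a * lyap_sum1 t)\<^sup>2 - (- a + lyap_sum t) * (a * (a * lyap_sum2 t))"
      using lyapunov_series_ode[OF abs_mult_exp_less[OF d a t]] by algebra
    ultimately show "((\<lambda>t. a * (a * lyap_sum2 t)) has_real_derivative
      ((2 * m - 1) / m - 1) * (a * lyap_sum1 t)\<^sup>2 - (- a + lyap_sum t) * (a * (a * lyap_sum2 t))) (at t within {..0})"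
      by (simp only:)
  qed
  fix \<epsilon> :: real assume \<epsilon>: "\<epsilon> \<in> {0<..<a}"
  have "((\<lambda>t. exp (- \<epsilon> * t) * lyap_sum t) \<longlongrightarrow> 0) at_bot"
    by (rule decay_of_scaled_lim[OF exp_series_lim[OF summable_h d a] \<epsilon>]) simp_all
  then show "((\<lambda>t. exp (- \<epsilon> * t) * (- a + lyap_sum t + a)) \<longlongrightarrow> 0) at_bot" by simp
  have "((\<lambda>t. exp (- \<epsilon> * t) * lyap_sum1 t) \<longlongrightarrow> 0) at_bot"
    by (rule decay_of_scaled_lim[OF exp_series_lim[OF summable_h1 d a] \<epsilon>]) simp_all
  from tendsto_mult_right_zero[OF this, of a]
  show "((\<lambda>t. exp (- \<epsilon> * t) * (a * lyap_sum1 t)) \<longlongrightarrow> 0) at_bot" by (simp add: mult_ac)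
  have "((\<lambda>t. exp (- \<epsilon> * t) * lyap_sum2 t) \<longlongrightarrow> 0) at_bot"
    by (rule decay_of_scaled_lim[OF exp_series_lim[OF summable_h2 d a] \<epsilon>]) simp_all
  from tendsto_mult_right_zero[OF this, of "a * a"]
  show "((\<lambda>t. exp (- \<epsilon> * t) * (a * (a * lyap_sum2 t))) \<longlongrightarrow> 0) at_bot" by (simp add: mult_ac)
qed

lemma series_amplitude: "decaying_solution.amplitude a (\<lambda>t. a * lyap_sum1 t) = a * d"
proof -
  interpret decaying_solution a "(2 * m - 1) / m" "\<lambda>t. - a + lyap_sum t" "\<lambda>t. a * lyap_sum1 t" "\<lambda>t. a * (a * lyap_sum2 t)"
    by (rule series_decaying_solution)
  have "((\<lambda>t. lyap_sum1 t * exp (- a * t)) \<longlongrightarrow> d * (real 1 * lyap_coeff m a 1)) at_bot"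
    by (rule exp_series_lim[OF summable_h1 d a]) simp_all
  from tendsto_mult[OF tendsto_const this]
  have "((\<lambda>t. a * (lyap_sum1 t * exp (- a * t))) \<longlongrightarrow> a * (d * (real 1 * lyap_coeff m a 1))) at_bot" .
  then have "((\<lambda>t. a * lyap_sum1 t * exp (- a * t)) \<longlongrightarrow> a * d) at_bot" by (simp add: mult.assoc)
  then show ?thesis using tendsto_unique[OF trivial_limit_at_bot_linorder amplitude_lim] by simp
qed

lemma series_lyapunov_solution: "lyapunov_solution m a d 0 (\<lambda>t. - a + lyap_sum t)"
  unfolding lyapunov_solution_def
proof (intro conjI exI[of _ 1] allI impI)
  show "ode_solution_on m {..0} (\<lambda>t. - a + lyap_sum t)"
    by (rule decaying_solution.ode_solution_on_half_line[OF series_decaying_solution refl])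
  fix t :: real assume "t \<le> 0"
  then have "summable (\<lambda>n. lyap_coeff m a n * (d * exp (a * t)) ^ n)"
    by (intro summable_h abs_mult_exp_less[OF d a])
  then have "(\<lambda>n. lyap_coeff m a n * (d * exp (a * t)) ^ n) sums lyap_sum t" by (rule summable_sums)
  then have "(\<lambda>n. lyap_coeff m a (Suc n) * (d * exp (a * t)) ^ Suc n) sums lyap_sum t"
    by (subst sums_Suc_iff) simp
  moreover have "(d * exp (a * t)) ^ Suc n = d ^ Suc n * exp (real (Suc n) * a * t)" for n
    unfolding power_mult_distrib exp_of_nat_mult[symmetric] by (simp only: mult.assoc)
  ultimately show "(\<lambda>n. lyap_coeff m a (Suc n) * d ^ Suc n * exp (real (Suc n) * a * t)) sums (- a + lyap_sum t + a)"
    by (simp only: mult.assoc) simp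
qed simp

end

text \<open>
  At \<open>d = 2 a\<close> the amplitude is \<open>2 a\<^sup>2\<close>, so the quotient in
  \<open>amplitude_le_endpoint\<close> starts from \<open>1\<close> and \<open>\<Phi> 0 \<ge> 0\<close>
  follows. As \<open>\<Phi> 0 = - a\<close> for \<open>d = 0\<close>, some parameter in between gives
  \<open>\<Phi> 0 = 0\<close>.
\<close>

lemma exists_anchored_series:
  assumes r: "2 * a < r"
  obtains d \<Phi> where "0 < d" "bvp_solution m a \<Phi>" "lyapunov_solution m a d 0 \<Phi>"
proof -
  define F where "F = (\<lambda>x. \<Sum>n. lyap_coeff m a n * x ^ n)"
  have value_ge: "a \<le> F (2 * a)"
  proof (rule ccontr)
    assume less: "\<not> a \<le> F (2 * a)"
    have d: "\<bar>2 * a\<bar> < r" using r a by simp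
    interpret decaying_solution a "(2 * m - 1) / m"
      "\<lambda>t. - a + (\<Sum>n. lyap_coeff m a n * (2 * a * exp (a * t)) ^ n)"
      "\<lambda>t. a * (\<Sum>n. real n * lyap_coeff m a n * (2 * a * exp (a * t)) ^ n)"
      "\<lambda>t. a * (a * (\<Sum>n. real n * (real n * lyap_coeff m a n) * (2 * a * exp (a * t)) ^ n))"
      by (rule series_decaying_solution[OF d])
    have amp: "amplitude = a * (2 * a)" by (rule series_amplitude[OF d])
    have "amplitude / (2 * a\<^sup>2) \<le> (- a + F (2 * a) + a) / (a - (- a + F (2 * a)))"
      using amplitude_le_endpoint less amp a by (simp add: F_def)
    moreover have "amplitude / (2 * a\<^sup>2) = 1" using amp a by (simp add: power2_eq_square)
    moreover have "0 < a - (- a + F (2 * a))" using less a by simp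
    ultimately show False using less a by (simp add: pos_le_divide_eq)
  qed
  have "continuous_on {0..2 * a} F"
  proof (rule DERIV_continuous_on)
    fix x assume "x \<in> {0..2 * a}"
    then have "norm x < r" using r by auto
    then have "DERIV F x :> (\<Sum>n. diffs (lyap_coeff m a) n * x ^ n)"
      unfolding F_def by (intro termdiffs_strong'[of r] summable_h) auto
    then show "(F has_field_derivative (\<Sum>n. diffs (lyap_coeff m a) n * x ^ n)) (at x within {0..2 * a})"
      by (rule has_field_derivative_at_within)
  qed
  moreover have F0: "F 0 = 0" by (simp add: F_def)
  ultimately obtain d where d: "0 \<le> d" "d \<le> 2 * a" "F d = a"
    using IVT'[of F 0 a "2 * a"] value_ge a by auto
  have "0 < d" using d F0 a by (cases "d = 0") auto
  have dr: "\<bar>d\<bar> < r" using d r by simp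
  interpret decaying_solution a "(2 * m - 1) / m"
      "\<lambda>t. - a + (\<Sum>n. lyap_coeff m a n * (d * exp (a * t)) ^ n)"
      "\<lambda>t. a * (\<Sum>n. real n * lyap_coeff m a n * (d * exp (a * t)) ^ n)"
      "\<lambda>t. a * (a * (\<Sum>n. real n * (real n * lyap_coeff m a n) * (d * exp (a * t)) ^ n))"
    by (rule series_decaying_solution[OF dr])
  show ?thesis
  proof (rule that[OF \<open>0 < d\<close> _ series_lyapunov_solution[OF dr]])
    show "bvp_solution m a (\<lambda>t. - a + (\<Sum>n. lyap_coeff m a n * (d * exp (a * t)) ^ n))"
      by (rule bvp_solution_of_anchored[OF refl]) (use d(3) in \<open>simp add: F_def\<close>)
  qed
qed

end

lemma lyap_coeff_summable:
  assumes m: "1 / 2 \<le> m" and a: "0 < a" and x: "\<bar>x\<bar> < 2 * a / (1 - (2 * m - 1) / m / 3)"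
  shows "summable (\<lambda>n. lyap_coeff m a n * x ^ n)"
proof -
  define A where "A = (1 - (2 * m - 1) / m / 3) / (2 * a)"
  have "(2 * m - 1) / m \<le> 2" using m by (simp add: field_simps)
  then have A: "0 < A" using a by (simp add: A_def)
  have "\<bar>x\<bar> < 1 / A" using x by (simp add: A_def)
  then have q: "A * \<bar>x\<bar> < 1" using A by (simp add: pos_less_divide_eq mult.commute)
  have "summable (\<lambda>n. (A * \<bar>x\<bar>) ^ n / A)"
    by (intro summable_divide summable_geometric) (use q A in auto)
  then show ?thesis
  proof (rule summable_comparison_test'[where N = 1])
    fix n :: nat assume n: "1 \<le> n"
    have "norm (lyap_coeff m a n * x ^ n) \<le> A ^ (n - 1) * \<bar>x\<bar> ^ n"
      using lyap_coeff_bound[OF m a n] unfolding A_def by (simp add: abs_mult power_abs mult_right_mono)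
    also have "A ^ (n - 1) = A ^ n / A" using n A by (simp add: power_diff)
    finally show "norm (lyap_coeff m a n * x ^ n) \<le> (A * \<bar>x\<bar>) ^ n / A" by (simp add: power_mult_distrib)
  qed
qed

lemma tanh_decaying_solution:
  assumes a: "0 < a"
  defines "\<Phi> \<equiv> \<lambda>t. a * (exp (a * t) - 1) / (exp (a * t) + 1)"
  shows "decaying_solution a 0 \<Phi> (\<lambda>t. (a\<^sup>2 - (\<Phi> t)\<^sup>2) / 2) (\<lambda>t. - \<Phi> t * ((a\<^sup>2 - (\<Phi> t)\<^sup>2) / 2))"
proof
  have ne: "exp x + 1 \<noteq> (0::real)" for x using exp_gt_zero[of x] by linarith
  show "0 < a" "(0::real) \<le> 0" "(0::real) \<le> 2" using a by auto
  have Phi: "(\<Phi> has_real_derivative (a\<^sup>2 - (\<Phi> t)\<^sup>2) / 2) (at t within {..0})" for t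
  proof -
    have "(\<Phi> has_real_derivative (a * (a * exp (a * t)) * (exp (a * t) + 1) - a * (exp (a * t) - 1) * (a * exp (a * t)))
        / (exp (a * t) + 1)\<^sup>2) (at t within {..0})"
      unfolding \<Phi>_def
      by (rule derivative_eq_intros refl ne)+ (simp add: power2_eq_square)
    moreover have alg: "(a * (a * e) * (e + 1) - a * (e - 1) * (a * e)) / (e + 1)\<^sup>2
      = (a\<^sup>2 - (a * (e - 1) / (e + 1))\<^sup>2) / 2" if "e + 1 \<noteq> 0" for e :: real
      using that by (simp add: power_divide divide_simps) (simp add: algebra_simps power2_eq_square)
    ultimately show ?thesis unfolding \<Phi>_def alg[OF ne] by (simp only:)
  qed
  then show "has_deriv_half_line \<Phi> (\<lambda>t. (a\<^sup>2 - (\<Phi> t)\<^sup>2) / 2)" by blast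
  have P: "((\<lambda>t. (a\<^sup>2 - (\<Phi> t)\<^sup>2) / 2) has_real_derivative - \<Phi> t * ((a\<^sup>2 - (\<Phi> t)\<^sup>2) / 2)) (at t within {..0})" for t
    by (rule DERIV_cong[OF DERIV_cdivide[OF DERIV_diff[OF DERIV_const DERIV_power[OF Phi]]]]) simp
  then show "has_deriv_half_line (\<lambda>t. (a\<^sup>2 - (\<Phi> t)\<^sup>2) / 2) (\<lambda>t. - \<Phi> t * ((a\<^sup>2 - (\<Phi> t)\<^sup>2) / 2))" by blast
  have alg: "- x * x + - f * x * - f = (0 - 1) * x\<^sup>2 - f * (- f * x)" for x f :: real
    by (simp add: power2_eq_square)
  have "((\<lambda>t. - \<Phi> t * ((a\<^sup>2 - (\<Phi> t)\<^sup>2) / 2)) has_real_derivative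
    (0 - 1) * ((a\<^sup>2 - (\<Phi> t)\<^sup>2) / 2)\<^sup>2 - \<Phi> t * (- \<Phi> t * ((a\<^sup>2 - (\<Phi> t)\<^sup>2) / 2))) (at t within {..0})" for t
    by (rule DERIV_cong[OF DERIV_mult[OF DERIV_minus[OF Phi] P] alg])
  then show "has_deriv_half_line (\<lambda>t. - \<Phi> t * ((a\<^sup>2 - (\<Phi> t)\<^sup>2) / 2))
    (\<lambda>t. (0 - 1) * ((a\<^sup>2 - (\<Phi> t)\<^sup>2) / 2)\<^sup>2 - \<Phi> t * (- \<Phi> t * ((a\<^sup>2 - (\<Phi> t)\<^sup>2) / 2)))" by blast
  have e: "((\<lambda>t. exp (a * t)) \<longlongrightarrow> 0) at_bot" by (rule exp_scaled_at_bot[OF a])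
  have "((\<lambda>t. 2 * a / (exp (a * t) + 1)) \<longlongrightarrow> 2 * a / (0 + 1)) at_bot"
    by (intro tendsto_intros e) simp
  moreover have "2 * a / (exp (a * t) + 1) = (\<Phi> t + a) * exp (- a * t)" for t
    using ne[of "a * t"] by (simp add: \<Phi>_def exp_minus divide_simps) (simp add: algebra_simps)
  ultimately have s0: "((\<lambda>t. (\<Phi> t + a) * exp (- a * t)) \<longlongrightarrow> 2 * a) at_bot" by simp
  have "((\<lambda>t. a * (exp (a * t) - 1) / (exp (a * t) + 1)) \<longlongrightarrow> a * (0 - 1) / (0 + 1)) at_bot"
    by (intro tendsto_intros e) simp
  then have Phi_lim: "(\<Phi> \<longlongrightarrow> - a) at_bot" by (simp add: \<Phi>_def)
  have P_eq: "(\<Phi> t + a) * exp (- a * t) * ((a - \<Phi> t) / 2) = (a\<^sup>2 - (\<Phi> t)\<^sup>2) / 2 * exp (- a * t)" for t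
  proof -
    have "(f + a) * e * ((a - f) / 2) = (a\<^sup>2 - f\<^sup>2) / 2 * e" for e f :: real
      by (simp add: field_simps power2_eq_square)
    then show ?thesis .
  qed
  have "((\<lambda>t. (\<Phi> t + a) * exp (- a * t) * ((a - \<Phi> t) / 2)) \<longlongrightarrow> 2 * a * ((a - - a) / 2)) at_bot"
    by (intro tendsto_intros s0 Phi_lim) simp
  then have s1: "((\<lambda>t. (a\<^sup>2 - (\<Phi> t)\<^sup>2) / 2 * exp (- a * t)) \<longlongrightarrow> 2 * a * ((a - - a) / 2)) at_bot"
    unfolding P_eq .
  have "((\<lambda>t. - \<Phi> t * ((a\<^sup>2 - (\<Phi> t)\<^sup>2) / 2 * exp (- a * t))) \<longlongrightarrow> - (- a) * (2 * a * ((a - - a) / 2))) at_bot"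
    by (intro tendsto_mult tendsto_minus s1 Phi_lim)
  then have s2: "((\<lambda>t. - \<Phi> t * ((a\<^sup>2 - (\<Phi> t)\<^sup>2) / 2) * exp (- a * t)) \<longlongrightarrow> - (- a) * (2 * a * ((a - - a) / 2))) at_bot"
    by (simp only: mult.assoc)
  fix \<epsilon> assume \<epsilon>: "\<epsilon> \<in> {0<..<a}"
  show "((\<lambda>t. exp (- \<epsilon> * t) * (\<Phi> t + a)) \<longlongrightarrow> 0) at_bot"
    "((\<lambda>t. exp (- \<epsilon> * t) * ((a\<^sup>2 - (\<Phi> t)\<^sup>2) / 2)) \<longlongrightarrow> 0) at_bot"
    "((\<lambda>t. exp (- \<epsilon> * t) * (- \<Phi> t * ((a\<^sup>2 - (\<Phi> t)\<^sup>2) / 2))) \<longlongrightarrow> 0) at_bot"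
    by (rule decay_of_scaled_lim[OF s0 \<epsilon>] decay_of_scaled_lim[OF s1 \<epsilon>] decay_of_scaled_lim[OF s2 \<epsilon>])+
qed

text \<open>
  Here \<open>c = 0\<close>. The parameter is \<open>d = 2 a\<close>, the radius of convergence of the
  geometric series, so the series represents the solution for \<open>\<tau> < 0\<close> but diverges at
  \<open>\<tau> = 0\<close>; this is why the solution is given in closed form.
\<close>

lemma exists_anchored_tanh:
  assumes a: "0 < a"
  obtains d \<Phi> where "0 < d" "bvp_solution (1 / 2) a \<Phi>" "lyapunov_solution (1 / 2) a d 0 \<Phi>"
proof -
  define \<Phi> where "\<Phi> = (\<lambda>t. a * (exp (a * t) - 1) / (exp (a * t) + 1))"
  interpret decaying_solution a 0 \<Phi> "\<lambda>t. (a\<^sup>2 - (\<Phi> t)\<^sup>2) / 2" "\<lambda>t. - \<Phi> t * ((a\<^sup>2 - (\<Phi> t)\<^sup>2) / 2)"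
    unfolding \<Phi>_def by (rule tanh_decaying_solution[OF a])
  have c: "0 = (2 * (1 / 2) - 1) / (1 / 2 :: real)" by simp
  show ?thesis
  proof (rule that)
    \<comment> \<open>The amplitude of \<open>a tanh (a t / 2)\<close> is \<open>2 a\<^sup>2\<close>, which is \<open>a d\<close> for \<open>d = 2 a\<close>.\<close>
    show "0 < 2 * a" using a by simp
    show "bvp_solution (1 / 2) a \<Phi>" by (rule bvp_solution_of_anchored[OF c]) (simp add: \<Phi>_def)
    show "lyapunov_solution (1 / 2) a (2 * a) 0 \<Phi>"
      unfolding lyapunov_solution_def
    proof (intro conjI exI[of _ "2 * a"] allI impI)
      show "ode_solution_on (1 / 2) {..0} \<Phi>" by (rule ode_solution_on_half_line[OF c])
      fix t :: real assume t: "t \<le> 0" and less: "\<bar>2 * a * exp (a * t)\<bar> < 2 * a"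
      define e where "e = exp (a * t)"
      have e: "0 < e" "e < 1" using less a by (auto simp: e_def abs_mult)
      have "(\<lambda>n. 2 * a * e * (- e) ^ n) sums (2 * a * e * (1 / (1 - (- e))))"
        by (intro sums_mult geometric_sums) (use e in auto)
      moreover have "2 * a * e * (1 / (1 - (- e))) = \<Phi> t + a"
        using e unfolding \<Phi>_def e_def[symmetric] by (simp add: divide_simps) (simp add: algebra_simps)
      moreover have "2 * a * e * (- e) ^ n
          = lyap_coeff (1 / 2) a (Suc n) * (2 * a) ^ Suc n * exp (real (Suc n) * a * t)" for n
      proof -
        have "exp (real (Suc n) * a * t) = e ^ Suc n"
          unfolding e_def exp_of_nat_mult[symmetric] by (simp only: mult.assoc)
        moreover have "lyap_coeff (1 / 2) a (Suc n) = (- 1 / (2 * a)) ^ n"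
          using lyap_coeff_half[OF a, of "Suc n"] by simp
        moreover have "(- 1 / (2 * a)) ^ n * (2 * a) ^ n * e ^ n = (- e) ^ n"
          unfolding power_mult_distrib[symmetric] using a by simp
        ultimately show ?thesis by (simp add: mult_ac)
      qed
      ultimately show "(\<lambda>n. lyap_coeff (1 / 2) a (Suc n) * (2 * a) ^ Suc n * exp (real (Suc n) * a * t)) sums (\<Phi> t + a)"
        by (simp only:)
    qed (use a in simp)
  qed
qed

lemma exists_bvp_solution:
  assumes m: "1 / 2 \<le> m" and a: "0 < a"
  obtains d \<Phi> where "0 < d" "bvp_solution m a \<Phi>" "lyapunov_solution m a d 0 \<Phi>"
proof (cases "m = 1 / 2")
  case True
  then show ?thesis using exists_anchored_tanh[OF a] that by blast
next
  case False
  define c where "c = (2 * m - 1) / m"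
  have c: "0 < c" "c \<le> 2" using m False by (auto simp: c_def field_simps)
  have "2 * a * (1 - c / 3) < 2 * a" using a c by simp
  then have "2 * a < 2 * a / (1 - c / 3)" using c by (simp add: pos_less_divide_eq)
  then show ?thesis
    using exists_anchored_series[OF m a lyap_coeff_summable[OF m a]] that unfolding c_def by blast
qed

section \<open>The boundary value problem\<close>

theorem theorem3p1:
  fixes m a :: real
  assumes "m \<ge> 1 / 2" and "a > 0"
  shows "\<exists>\<Phi>. bvp_solution m a \<Phi> \<and>
    (\<forall>\<Psi>. bvp_solution m a \<Psi> \<longrightarrow> (\<forall>\<tau>\<le>0. \<Psi> \<tau> = \<Phi> \<tau>)) \<and>
    convex_on {..0} \<Phi> \<and>
    strict_mono_on {..0} \<Phi> \<and>
    (\<exists>d>0. lyapunov_solution m a d 0 \<Phi>) \<and>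
    (let \<Phi>' = deriv_on {..0} \<Phi>; \<Phi>'' = deriv_on {..0} \<Phi>' in
      (\<forall>\<tau>\<le>0.
        (\<lambda>t. (\<Phi>' t)\<^sup>2) integrable_on {..\<tau>} \<and>
        \<Phi>'' \<tau> + \<Phi> \<tau> * \<Phi>' \<tau> = (2 * m - 1) / m * integral {..\<tau>} (\<lambda>t. (\<Phi>' t)\<^sup>2)) \<and>
      (\<forall>\<tau>\<le>0.
        (\<lambda>s. (\<tau> - s) * (\<Phi>' s)\<^sup>2) integrable_on {..\<tau>} \<and>
        \<Phi>' \<tau> = (a\<^sup>2 - (\<Phi> \<tau>)\<^sup>2) / 2
          + (2 * m - 1) / m * integral {..\<tau>} (\<lambda>s. (\<tau> - s) * (\<Phi>' s)\<^sup>2)) \<and>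
      \<Phi>'' 0 = (2 * m - 1) / m * integral {..0} (\<lambda>t. (\<Phi>' t)\<^sup>2) \<and>
      (\<lambda>s. s * (\<Phi>' s)\<^sup>2) integrable_on {..0} \<and>
      \<Phi>' 0 = a\<^sup>2 / 2 - (2 * m - 1) / m * integral {..0} (\<lambda>s. s * (\<Phi>' s)\<^sup>2)) \<and>
    (\<forall>\<tau>\<le>0. a * (exp (a * \<tau>) - 1) \<le> \<Phi> \<tau> \<and> \<Phi> \<tau> \<le> a * tanh (a * \<tau> / 2))"
proof -
  obtain d \<Phi> where d: "0 < d" and sol: "bvp_solution m a \<Phi>" and lyap: "lyapunov_solution m a d 0 \<Phi>"
    using exists_bvp_solution[OF assms] by blast
  define P where "P = deriv_on {..0} \<Phi>"
  define Q where "Q = deriv_on {..0} P"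
  define c where "c = (2 * m - 1) / m"
  interpret decaying_solution a c \<Phi> P Q
    unfolding Q_def P_def c_def by (rule decaying_solution_of_bvp_solution[OF assms sol])
  have anchored: "\<Phi> 0 = 0" using sol by (simp add: bvp_solution_def)
  note amp = amplitude_pos[OF anchored]
  have mono: "strict_mono_on {..0} \<Phi>"
    using Phi_strict_mono[OF amp] by (auto simp: strict_mono_on_def)
  have first: "(\<lambda>t. (P t)\<^sup>2) integrable_on {..\<tau>} \<and>
      Q \<tau> + \<Phi> \<tau> * P \<tau> = c * integral {..\<tau>} (\<lambda>t. (P t)\<^sup>2)" if "\<tau> \<le> 0" for \<tau>
    using energy_has_integral[OF that] first_integral[OF that]
    by (auto simp: has_integral_iff)
  have second: "(\<lambda>s. (\<tau> - s) * (P s)\<^sup>2) integrable_on {..\<tau>} \<and>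
      P \<tau> = (a\<^sup>2 - (\<Phi> \<tau>)\<^sup>2) / 2 + c * integral {..\<tau>} (\<lambda>s. (\<tau> - s) * (P s)\<^sup>2)" if "\<tau> \<le> 0" for \<tau>
    using double_energy_has_integral[OF that] second_integral[OF that]
    by (auto simp: has_integral_iff)
  have endpoint: "((\<lambda>s. s * (P s)\<^sup>2) has_integral - double_energy 0) {..0}"
    using has_integral_neg[OF double_energy_has_integral[of 0]] by simp
  have Q0: "Q 0 = c * integral {..0} (\<lambda>t. (P t)\<^sup>2)" using first[of 0] anchored by simp
  have int0: "(\<lambda>s. s * (P s)\<^sup>2) integrable_on {..0}" using endpoint by (rule has_integral_integrable)
  have P0: "P 0 = a\<^sup>2 / 2 - c * integral {..0} (\<lambda>s. s * (P s)\<^sup>2)"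
    using second_integral[of 0] anchored integral_unique[OF endpoint] by simp
  show ?thesis
    unfolding Let_def
  proof (intro exI[of _ \<Phi>] conjI allI impI, unfold P_def[symmetric] Q_def[symmetric] c_def[symmetric])
    show "\<exists>d>0. lyapunov_solution m a d 0 \<Phi>" using d lyap by blast
  qed (fact sol mono Q0 int0 P0 convex[OF anchored]
    | rule bvp_solution_unique[OF assms sol] first[THEN conjunct1] first[THEN conjunct2]
      second[THEN conjunct1] second[THEN conjunct2]
      exp_lower_bound[OF anchored] tanh_upper_bound[OF anchored] | assumption)+
qed

end
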